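(* Let $f\in H(\mathbb{D})$ be such that $\{f(rw):0\le r<1\}$ is unbounded for $m$-almost every $w\in\mathbb{T}$. Then for every $\zeta\in\mathbb{T}$ and every $r>0$, the set $\mathbb{C}\setminus f(D_{\zeta,r})$ is polar, where $D_{\zeta,r}=\{z\in\mathbb{D}:|z-\zeta|<r\}$. In particular, this holds for every $f\in\mathcal{U}_{ae}(\mathbb{D})$.
   Context: $\mathbb{D}$ is the open unit disc, $\mathbb{T}$ the unit circle, $m$ arclength measure on $\mathbb{T}$. For $f\in H(\mathbb{D})$ and $r\in[0,1)$, $f_r(z):=f(rz)$. $\mathcal{U}_{ae}(\mathbb{D})$ is the set of $f\in H(\mathbb{D})$ such that for every $m$-measurable function $\varphi$ on $\mathbb{T}$ there is a sequence $(r_n)$ in $[0,1)$ with $f_{r_n}(\zeta)\to\varphi(\zeta)$ for $m$-almost every $\zeta\in\mathbb{T}$. Polar means of zero logarithmic capacity (in the potential-theoretic sense). *)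

theory Defs
  imports "HOL-Analysis.Analysis"
begin

text \<open>Arclength measure m on the unit circle is represented via the parametrisation
  t \<mapsto> cis t, t in [0, 2 pi]; m-null sets / m-measurable functions correspond to
  Lebesgue-null sets / Lebesgue-measurable functions of t.\<close>

definition circ_measurable :: "(complex \<Rightarrow> complex) \<Rightarrow> bool" where
  "circ_measurable \<phi> \<longleftrightarrow> (\<lambda>t. \<phi> (cis t)) \<in> borel_measurable (lebesgue_on {0..2*pi})"

definition U_ae :: "(complex \<Rightarrow> complex) set" where
  "U_ae = {f. f holomorphic_on ball 0 1 \<and>
     (\<forall>\<phi>. circ_measurable \<phi> \<longrightarrow>
        (\<exists>r :: nat \<Rightarrow> real. (\<forall>n. 0 \<le> r n \<and> r n < 1) \<and>
           (AE t in lebesgue_on {0..2*pi}.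
              (\<lambda>n. f (complex_of_real (r n) * cis t)) \<longlonglongrightarrow> \<phi> (cis t))))}"

text \<open>Logarithmic energy I(mu) = double integral of log|z-w| d mu d mu, as an extended real
  (positive part minus negative part; log 0 = -infinity).\<close>
definition log_energy :: "complex measure \<Rightarrow> ereal" where
  "log_energy \<mu> =
     enn2ereal (\<integral>\<^sup>+ p. ennreal (max 0 (ln (cmod (fst p - snd p)))) \<partial>(\<mu> \<Otimes>\<^sub>M \<mu>))
   - enn2ereal (\<integral>\<^sup>+ p. (if fst p = snd p then \<infinity>
                  else ennreal (max 0 (- ln (cmod (fst p - snd p))))) \<partial>(\<mu> \<Otimes>\<^sub>M \<mu>))"

text \<open>Polar set (Ransford): I(mu) = -infinity for every finite nonzero Borel measure mu
  whose support is a compact subset of E (equivalently: mu is concentrated on a compact K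
  contained in E).\<close>
definition polar :: "complex set \<Rightarrow> bool" where
  "polar E \<longleftrightarrow>
    (\<forall>\<mu>. sets \<mu> = sets borel \<and> emeasure \<mu> UNIV < \<infinity> \<and> emeasure \<mu> UNIV \<noteq> 0 \<and>
          (\<exists>K. compact K \<and> K \<subseteq> E \<and> emeasure \<mu> (- K) = 0)
          \<longrightarrow> log_energy \<mu> = -\<infinity>)"

definition D_disc :: "complex \<Rightarrow> real \<Rightarrow> complex set" where
  "D_disc \<zeta> r = {z \<in> ball 0 1. cmod (z - \<zeta>) < r}"

end

theory Submission
  imports Defs "HOL-Complex_Analysis.Complex_Analysis"
begin

text \<open>If the complement of the image of \<open>D_disc \<zeta> r\<close> is not polar, it carries a nonzero measure
  \<open>\<nu>\<close> with compact support whose logarithmic potential is bounded below on the image. Composing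
  the potential with \<open>f\<close> and adding a constant gives a positive harmonic function
  \<open>v = Re F\<close> on \<open>D_disc \<zeta> r\<close> that tends to infinity together with \<open>|f|\<close>. A positive harmonic
  function is bounded on almost every radius ending on the arc, which contradicts the hypothesis
  on \<open>f\<close>.

  The boundedness is proved by a weak type estimate in a half-disc with real boundary, in the
  coordinate \<open>w\<close> with \<open>z = cis t * exp (\<i> \<delta> w)\<close>. If \<open>v \<ge> N\<close> at finitely many points
  \<open>a\<close> above well separated points of the real line, then by Harnack's inequality \<open>v \<ge> N / 3\<close> on
  the disc of radius \<open>Im a / 2\<close> about each \<open>a\<close>, so by the maximum principle \<open>v\<close> dominates a
  constant times \<open>N\<close> times the sum of the Green functions with poles \<open>a\<close>. At a fixed point that sum
  is comparable to the sum of the heights \<open>Im a\<close>, and Vitali's covering lemma concludes.\<close>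

subsection \<open>Logarithmic potentials\<close>

text \<open>If the energy is not \<open>-\<infinity>\<close>, the negative part \<open>u\<close> of
  the potential is finite almost everywhere, hence at most \<open>n\<close> on a set of positive
  measure. Restricting the measure to that set bounds its potential below there, and comparison with
  a nearly closest point carries the bound to every point off \<open>K\<close>.\<close>

lemma nonpolar_imp_bounded_potential:
  assumes "\<not> polar E"
  obtains \<nu> K M where "finite_measure \<nu>" "sets \<nu> = sets borel" "compact K" "K \<subseteq> E"
    "AE k in \<nu>. k \<in> K" "measure \<nu> UNIV > 0"
    "\<And>w. w \<notin> K \<Longrightarrow> - M \<le> (\<integral>k. ln (cmod (w - k)) \<partial>\<nu>)"
proof -
  obtain \<mu> K where \<mu>: "sets \<mu> = sets borel" "emeasure \<mu> UNIV < \<infinity>" "emeasure \<mu> UNIV \<noteq> 0"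
    and K: "compact K" "K \<subseteq> E" "emeasure \<mu> (- K) = 0" and en: "log_energy \<mu> \<noteq> -\<infinity>"
    using assms unfolding polar_def by blast
  have space: "space \<mu> = UNIV" using \<mu>(1) sets_eq_imp_space_eq[of \<mu> borel] by simp
  interpret \<mu>: finite_measure \<mu> by (rule finite_measureI) (use \<mu> space in auto)
  interpret \<mu>\<mu>: pair_sigma_finite \<mu> \<mu> by standard
  note \<mu>(1)[measurable_cong]
  have K_sets[measurable]: "K \<in> sets borel" using K by (simp add: borel_compact)
  have AE_K: "AE z in \<mu>. z \<in> K"
    by (rule AE_I[of _ _ "- K"]) (use K \<mu> space in auto)
  define s where "s p = (if fst p = snd p then \<infinity> else ennreal (max 0 (- ln (cmod (fst p - snd p)))))" for p
  have s_meas[measurable]: "s \<in> borel_measurable (\<mu> \<Otimes>\<^sub>M \<mu>)"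
    unfolding s_def by measurable
  have s_slice[measurable]: "(\<lambda>k. s (z, k)) \<in> borel_measurable borel" for z
    unfolding s_def fst_conv snd_conv by measurable
  \<comment> \<open>On the compact \<open>K\<close> the positive part of the kernel is bounded, so
    an infinite negative part would force the energy to be \<open>-\<infinity>\<close>.\<close>
  have fin2: "(\<integral>\<^sup>+ p. s p \<partial>(\<mu> \<Otimes>\<^sub>M \<mu>)) < \<infinity>"
  proof (rule ccontr)
    assume "\<not> ?thesis"
    then have inf: "(\<integral>\<^sup>+ p. s p \<partial>(\<mu> \<Otimes>\<^sub>M \<mu>)) = \<infinity>" by (simp add: less_top[symmetric])
    obtain R where R: "\<And>z. z \<in> K \<Longrightarrow> cmod z \<le> R" "R > 0"
      using compact_imp_bounded[OF K(1)] by (auto simp: bounded_pos)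
    have "(\<integral>\<^sup>+ p. ennreal (max 0 (ln (cmod (fst p - snd p)))) \<partial>(\<mu> \<Otimes>\<^sub>M \<mu>)) =
        (\<integral>\<^sup>+ z. (\<integral>\<^sup>+ w. ennreal (max 0 (ln (cmod (z - w)))) \<partial>\<mu>) \<partial>\<mu>)"
      by (subst \<mu>.nn_integral_fst[symmetric]) auto
    also have "\<dots> \<le> (\<integral>\<^sup>+ z. (\<integral>\<^sup>+ w. ennreal (2 * R) \<partial>\<mu>) \<partial>\<mu>)"
    proof (rule nn_integral_mono_AE, use AE_K in eventually_elim, rule nn_integral_mono_AE, use AE_K in eventually_elim)
      fix z w assume "z \<in> K" "w \<in> K"
      then have "cmod (z - w) \<le> 2 * R" using R(1)[of z] R(1)[of w] norm_triangle_ineq4[of z w] by linarith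
      moreover have "ln (cmod (z - w)) \<le> cmod (z - w)"
        by (cases "z = w") (auto intro: less_imp_le[OF ln_less_self])
      ultimately show "ennreal (max 0 (ln (cmod (z - w)))) \<le> ennreal (2 * R)"
        using R(2) by (intro ennreal_leI) auto
    qed
    also have "\<dots> < \<infinity>" using \<mu> space by (simp add: ennreal_mult_less_top)
    finally have "(\<integral>\<^sup>+ p. ennreal (max 0 (ln (cmod (fst p - snd p)))) \<partial>(\<mu> \<Otimes>\<^sub>M \<mu>)) < \<infinity>" .
    then have "enn2ereal (\<integral>\<^sup>+ p. ennreal (max 0 (ln (cmod (fst p - snd p)))) \<partial>(\<mu> \<Otimes>\<^sub>M \<mu>)) < \<infinity>"
      by (metis enn2ereal_top infinity_ennreal_def less_ennreal.rep_eq)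
    then have "log_energy \<mu> = -\<infinity>"
      using inf unfolding log_energy_def s_def
      by (cases "enn2ereal (\<integral>\<^sup>+ p. ennreal (max 0 (ln (cmod (fst p - snd p)))) \<partial>(\<mu> \<Otimes>\<^sub>M \<mu>))") auto
    with en show False by simp
  qed
  define u where "u z = (\<integral>\<^sup>+ w. s (z, w) \<partial>\<mu>)" for z
  have u_meas[measurable]: "u \<in> borel_measurable borel"
    using \<mu>.borel_measurable_nn_integral_fst[OF s_meas] unfolding u_def
    by (simp cong: measurable_cong_sets add: \<mu>)
  have "(\<integral>\<^sup>+ z. u z \<partial>\<mu>) < \<infinity>"
    using fin2 \<mu>.nn_integral_fst[OF s_meas] by (simp add: u_def)
  then have "AE z in \<mu>. u z \<noteq> \<infinity>"
    by (intro nn_integral_PInf_AE) (auto cong: measurable_cong_sets simp: \<mu>)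
  then have AE_u: "AE z in \<mu>. z \<in> K \<and> u z \<noteq> \<infinity>" using AE_K by eventually_elim auto
  define A where "A n = {z \<in> K. u z \<le> of_nat n}" for n :: nat
  have A_sets[measurable]: "A n \<in> sets borel" for n
    unfolding A_def by measurable
  \<comment> \<open>The sets \<open>A n\<close> exhaust \<open>K\<close> up to a null set, so they
    cannot all be null.\<close>
  have "\<exists>n. emeasure \<mu> (A n) \<noteq> 0"
  proof (rule ccontr)
    assume "\<not> ?thesis"
    then have "A n \<in> null_sets \<mu>" for n using \<mu> by (auto simp: null_sets_def)
    then have "(\<Union>n. A n) \<in> null_sets \<mu>" by (rule null_sets_UN)
    then have "AE z in \<mu>. z \<notin> (\<Union>n. A n)" by (rule AE_not_in)
    with AE_u have "AE z in \<mu>. False"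
    proof eventually_elim
      case (elim z)
      then obtain n where "u z \<le> of_nat n"
        using ennreal_Ex_less_of_nat[of "u z"] by (auto simp: less_top intro: less_imp_le)
      with elim show ?case by (auto simp: A_def)
    qed
    then show False using \<mu> space by (simp add: AE_iff_null null_sets_def)
  qed
  then obtain n where n: "emeasure \<mu> (A n) \<noteq> 0" by blast
  define \<nu> where "\<nu> = density \<mu> (indicator (A n))"
  have sets_\<nu>: "sets \<nu> = sets borel" by (simp add: \<nu>_def \<mu>)
  have em_\<nu>: "emeasure \<nu> UNIV = emeasure \<mu> (A n)"
    unfolding \<nu>_def using \<mu> space by (subst emeasure_density) (auto cong: measurable_cong_sets)
  have fin_\<nu>: "emeasure \<nu> UNIV < \<infinity>"
    unfolding em_\<nu> by (simp add: less_top[symmetric])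
  have space_\<nu>: "space \<nu> = UNIV" using space by (simp add: \<nu>_def)
  interpret \<nu>: finite_measure \<nu> by (rule finite_measureI) (use fin_\<nu> space_\<nu> in auto)
  have AE_A: "AE k in \<nu>. k \<in> A n"
    unfolding \<nu>_def by (subst AE_density) (auto cong: measurable_cong_sets simp: \<mu> indicator_def)
  have u_\<nu>: "(\<integral>\<^sup>+ k. s (z, k) \<partial>\<nu>) \<le> of_nat n" if "z \<in> A n" for z
  proof -
    have "(\<integral>\<^sup>+ k. s (z, k) \<partial>\<nu>) = (\<integral>\<^sup>+ k. indicator (A n) k * s (z, k) \<partial>\<mu>)"
      unfolding \<nu>_def by (rule nn_integral_density) (auto cong: measurable_cong_sets simp: \<mu>)
    also have "\<dots> \<le> u z" unfolding u_def by (intro nn_integral_mono) (auto simp: indicator_def)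
    also have "u z \<le> of_nat n" using that by (simp add: A_def)
    finally show ?thesis .
  qed
  have "A n \<noteq> {}" using n by auto
  \<comment> \<open>The summand \<open>n\<close> bounds the negative part on \<open>A n\<close>;
    \<open>ln 3\<close> is the cost, per unit of mass, of moving from a point of \<open>A n\<close>
    to \<open>w\<close>.\<close>
  define M where "M = real n + measure \<nu> UNIV * ln 3"
  have "- M \<le> (\<integral>k. ln (cmod (w - k)) \<partial>\<nu>)" if "w \<notin> K" for w
  proof -
    \<comment> \<open>Compare with the potential at a point \<open>z\<close> of \<open>A n\<close> that is almost nearest to \<open>w\<close>:
      then \<open>|z - k| \<le> 3 |w - k|\<close> for all \<open>k \<in> A n\<close>.\<close>
    have "A n \<subseteq> K" by (auto simp: A_def)
    have "w \<notin> closure (A n)"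
      using that closure_minimal[OF \<open>A n \<subseteq> K\<close> compact_imp_closed[OF K(1)]] by blast
    then have pos: "infdist w (A n) > 0"
      using \<open>A n \<noteq> {}\<close> infdist_nonneg[of w "A n"] by (auto simp: in_closure_iff_infdist_zero order_less_le)
    then obtain z where z: "z \<in> A n" "dist w z < 2 * infdist w (A n)"
      using \<open>A n \<noteq> {}\<close> cInf_lessD[of "dist w ` A n" "2 * infdist w (A n)"] by (auto simp: infdist_notempty)
    have le: "ennreal (max 0 (- ln (cmod (w - k)))) \<le> s (z, k) + ennreal (ln 3)" if k: "k \<in> A n" for k
    proof (cases "z = k")
      case False
      have "infdist w (A n) \<le> cmod (w - k)" using infdist_le[OF k, of w] by (simp add: dist_norm)
      moreover have "cmod (z - k) \<le> dist w z + cmod (w - k)"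
        using norm_triangle_ineq[of "z - w" "w - k"] by (simp add: dist_norm norm_minus_commute)
      ultimately have "cmod (z - k) \<le> 3 * cmod (w - k)" "0 < cmod (w - k)" using z pos by linarith+
      then have "ln (cmod (z - k)) \<le> ln (3 * cmod (w - k))" using False by simp
      then have "max 0 (- ln (cmod (w - k))) \<le> max 0 (- ln (cmod (z - k))) + ln 3"
        using \<open>0 < cmod (w - k)\<close> by (simp add: ln_mult max_def)
      then show ?thesis using False by (simp add: s_def flip: ennreal_plus)
    qed (simp add: s_def)
    have "(\<integral>\<^sup>+ k. ennreal (max 0 (- ln (cmod (w - k)))) \<partial>\<nu>) \<le> (\<integral>\<^sup>+ k. s (z, k) + ennreal (ln 3) \<partial>\<nu>)"
      by (rule nn_integral_mono_AE, use AE_A in eventually_elim) (rule le)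
    also have "\<dots> = (\<integral>\<^sup>+ k. s (z, k) \<partial>\<nu>) + (\<integral>\<^sup>+ k. ennreal (ln 3) \<partial>\<nu>)"
      by (rule nn_integral_add) (auto cong: measurable_cong_sets simp: sets_\<nu>)
    also have "(\<integral>\<^sup>+ k. ennreal (ln 3) \<partial>\<nu>) = ennreal (measure \<nu> UNIV * ln 3)"
      using space_\<nu> \<nu>.emeasure_eq_measure[of UNIV] by (simp add: ennreal_mult' mult.commute)
    also have "(\<integral>\<^sup>+ k. s (z, k) \<partial>\<nu>) + ennreal (measure \<nu> UNIV * ln 3) \<le> of_nat n + ennreal (measure \<nu> UNIV * ln 3)"
      using u_\<nu>[OF z(1)] by (rule add_right_mono)
    also have "\<dots> = ennreal M" by (simp add: M_def ennreal_of_nat_eq_real_of_nat flip: ennreal_plus)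
    finally have neg: "(\<integral>\<^sup>+ k. ennreal (max 0 (- ln (cmod (w - k)))) \<partial>\<nu>) \<le> ennreal M" .
    have M0: "M \<ge> 0" by (simp add: M_def)
    have int: "integrable \<nu> (\<lambda>k. max 0 (- ln (cmod (w - k))))"
      using neg by (intro integrableI_nonneg) (auto cong: measurable_cong_sets simp: sets_\<nu> intro: le_less_trans)
    have "(\<integral>k. max 0 (- ln (cmod (w - k))) \<partial>\<nu>) \<le> M"
      using neg M0 by (subst integral_eq_nn_integral) (auto cong: measurable_cong_sets simp: sets_\<nu> enn2real_leI)
    moreover have "- (\<integral>k. ln (cmod (w - k)) \<partial>\<nu>) = (\<integral>k. - ln (cmod (w - k)) \<partial>\<nu>)" by simp
    \<comment> \<open>\<open>integral_mono'\<close> asks for integrability of the majorant only: a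
      non-integrable integrand would have integral 0, which the nonnegative right side
      dominates.\<close>
    moreover have "(\<integral>k. - ln (cmod (w - k)) \<partial>\<nu>) \<le> (\<integral>k. max 0 (- ln (cmod (w - k))) \<partial>\<nu>)"
      by (rule integral_mono'[OF int]) auto
    ultimately show ?thesis by linarith
  qed
  moreover have "AE k in \<nu>. k \<in> K" using AE_A by eventually_elim (simp add: A_def)
  moreover have "measure \<nu> UNIV > 0"
    using n em_\<nu> by (simp add: measure_def enn2real_positive_iff fin_\<nu> less_top[symmetric] zero_less_iff_neq_zero)
  ultimately show thesis
    using that \<nu>.finite_measure_axioms sets_\<nu> K by blast
qed

text \<open>Far from the support each \<open>cmod (w - k)\<close> is at least
  \<open>cmod w / 2\<close>. Through this bound large values of \<open>f\<close> become large values
  of the harmonic function.\<close>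

lemma log_potential_lower_bound:
  assumes "finite_measure \<nu>" "sets \<nu> = sets borel" "AE k in \<nu>. cmod k \<le> R" "R \<ge> 1" "cmod w \<ge> 2 * R"
  shows "(\<integral>k. ln (cmod (w - k)) \<partial>\<nu>) \<ge> measure \<nu> UNIV * ln (cmod w / 2)"
proof -
  interpret finite_measure \<nu> by fact
  have space: "space \<nu> = UNIV" using assms(2) sets_eq_imp_space_eq[of \<nu> borel] by simp
  have *: "cmod w / 2 \<le> cmod (w - k)" "cmod (w - k) \<le> 2 * cmod w" if "cmod k \<le> R" for k
    using that assms(4,5) norm_triangle_ineq2[of w k] norm_triangle_ineq4[of w k] by auto
  have w: "cmod w / 2 \<ge> 1" using assms by linarith
  have "measure \<nu> UNIV * ln (cmod w / 2) = (\<integral>k. ln (cmod w / 2) \<partial>\<nu>)"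
    using space by simp
  also have "\<dots> \<le> (\<integral>k. ln (cmod (w - k)) \<partial>\<nu>)"
  proof (rule integral_mono_AE)
    show "integrable \<nu> (\<lambda>k. ln (cmod (w - k)))"
    proof (rule integrable_const_bound)
      show "AE k in \<nu>. norm (ln (cmod (w - k))) \<le> ln (2 * cmod w)"
        using assms(3)
      proof eventually_elim
        case (elim k)
        then have "1 \<le> cmod (w - k)" "cmod (w - k) \<le> 2 * cmod w" using *[of k] w by auto
        then show ?case using ln_ge_zero ln_mono[of "cmod (w - k)" "2 * cmod w"] by fastforce
      qed
    qed (simp cong: measurable_cong_sets add: assms)
    show "AE k in \<nu>. ln (cmod w / 2) \<le> ln (cmod (w - k))"
      using assms(3)
    proof eventually_elim
      case (elim k)
      then show ?case using *[of k] w by (intro ln_mono) auto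
    qed
  qed auto
  finally show ?thesis .
qed

section \<open>Differentiating potentials under the integral sign\<close>

text \<open>A second-order remainder that is uniform in \<open>k\<close> stays of second order after
  integration against a finite measure. Both the Cauchy transform and the logarithmic potential are
  treated this way.\<close>

lemma has_derivative_integral_quadratic:
  fixes \<phi> :: "complex \<Rightarrow> complex \<Rightarrow> 'b::{banach,second_countable_topology}"
  assumes "finite_measure \<nu>" and "d > 0" "B \<ge> 0"
    and int: "\<And>w. cmod (w - w0) < d \<Longrightarrow> integrable \<nu> (\<phi> w)"
    and int': "\<And>h. integrable \<nu> (\<lambda>k. \<phi>' k h)"
    and lin: "bounded_linear (\<lambda>h. \<integral>k. \<phi>' k h \<partial>\<nu>)"
    and quad: "AE k in \<nu>. \<forall>w. cmod (w - w0) < d \<longrightarrow>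
      norm (\<phi> w k - \<phi> w0 k - \<phi>' k (w - w0)) \<le> B * (cmod (w - w0))\<^sup>2"
  shows "((\<lambda>w. \<integral>k. \<phi> w k \<partial>\<nu>) has_derivative (\<lambda>h. \<integral>k. \<phi>' k h \<partial>\<nu>)) (at w0)"
proof -
  interpret finite_measure \<nu> by fact
  define C where "C = B * measure \<nu> (space \<nu>)"
  have bound: "norm ((\<integral>k. \<phi> w k \<partial>\<nu>) - (\<integral>k. \<phi> w0 k \<partial>\<nu>) - (\<integral>k. \<phi>' k (w - w0) \<partial>\<nu>)) \<le> C * (cmod (w - w0))\<^sup>2"
    if w: "cmod (w - w0) < d" for w
  proof -
    have ints: "integrable \<nu> (\<phi> w)" "integrable \<nu> (\<phi> w0)" using int w \<open>d > 0\<close> by auto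
    have "(\<integral>k. \<phi> w k \<partial>\<nu>) - (\<integral>k. \<phi> w0 k \<partial>\<nu>) - (\<integral>k. \<phi>' k (w - w0) \<partial>\<nu>) =
        (\<integral>k. \<phi> w k - \<phi> w0 k - \<phi>' k (w - w0) \<partial>\<nu>)"
      using ints int' by simp
    also have "norm \<dots> \<le> (\<integral>k. norm (\<phi> w k - \<phi> w0 k - \<phi>' k (w - w0)) \<partial>\<nu>)"
      by (rule integral_norm_bound)
    also have "\<dots> \<le> (\<integral>k. B * (cmod (w - w0))\<^sup>2 \<partial>\<nu>)"
      using quad w by (intro integral_mono_AE integrable_norm Bochner_Integration.integrable_diff ints int') (auto elim!: eventually_mono)
    finally show ?thesis by (simp add: C_def mult_ac)
  qed
  have "C \<ge> 0" using \<open>B \<ge> 0\<close> by (simp add: C_def)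
  show ?thesis
    unfolding has_derivative_at_alt
  proof (intro conjI allI impI lin)
    fix e :: real assume "e > 0"
    define \<delta> where "\<delta> = min d (e / (C + 1))"
    have "\<delta> > 0" using \<open>d > 0\<close> \<open>e > 0\<close> \<open>C \<ge> 0\<close> by (simp add: \<delta>_def)
    moreover have "norm ((\<integral>k. \<phi> w k \<partial>\<nu>) - (\<integral>k. \<phi> w0 k \<partial>\<nu>) - (\<integral>k. \<phi>' k (w - w0) \<partial>\<nu>)) \<le> e * norm (w - w0)"
      if w: "norm (w - w0) < \<delta>" for w
    proof -
      have "cmod (w - w0) \<le> e / (C + 1)" using w by (simp add: \<delta>_def)
      then have "(C + 1) * cmod (w - w0) \<le> e"
        using \<open>C \<ge> 0\<close> by (simp add: pos_le_divide_eq mult.commute)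
      moreover have "C * cmod (w - w0) \<le> (C + 1) * cmod (w - w0)" by (simp add: distrib_right)
      ultimately have "C * cmod (w - w0) \<le> e" by (rule order_trans[rotated])
      then have "C * cmod (w - w0) * cmod (w - w0) \<le> e * cmod (w - w0)"
        by (intro mult_right_mono) auto
      moreover have "cmod (w - w0) < d" using w by (simp add: \<delta>_def)
      ultimately show ?thesis using bound[of w] by (simp add: power2_eq_square mult.assoc)
    qed
    ultimately show "\<exists>\<delta>>0. \<forall>w. norm (w - w0) < \<delta> \<longrightarrow>
        norm ((\<integral>k. \<phi> w k \<partial>\<nu>) - (\<integral>k. \<phi> w0 k \<partial>\<nu>) - (\<integral>k. \<phi>' k (w - w0) \<partial>\<nu>)) \<le> e * norm (w - w0)"
      by blast
  qed
qed

text \<open>The Cauchy transform is the complex gradient of the logarithmic potential. Because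
  \<open>w0\<close> has positive distance from \<open>K\<close>, the remainders of both kernels are
  quadratic uniformly in \<open>k\<close>.\<close>

lemma
  assumes "finite_measure \<nu>" "sets \<nu> = sets borel" "compact K" "AE k in \<nu>. k \<in> K" "w0 \<notin> K"
  shows cauchy_transform_has_field_derivative:
      "((\<lambda>w. \<integral>k. 1 / (w - k) \<partial>\<nu>) has_field_derivative (\<integral>k. - 1 / (w0 - k)\<^sup>2 \<partial>\<nu>)) (at w0)"
    and log_potential_has_derivative:
      "((\<lambda>w. \<integral>k. ln (cmod (w - k)) \<partial>\<nu>) has_derivative (\<lambda>h. Re (h * (\<integral>k. 1 / (w0 - k) \<partial>\<nu>)))) (at w0)"
proof -
  interpret finite_measure \<nu> by fact
  note assms(2)[measurable_cong]
  obtain d where d: "d > 0" "\<And>k. k \<in> K \<Longrightarrow> d \<le> dist w0 k"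
    using separate_point_closed[OF compact_imp_closed[OF assms(3)] assms(5)] by blast
  obtain R where R: "\<And>z. z \<in> K \<Longrightarrow> cmod z \<le> R" "R > 0"
    using compact_imp_bounded[OF assms(3)] by (auto simp: bounded_pos)
  have far: "d / 2 \<le> cmod (w - k)" "d \<le> cmod (w0 - k)" if "k \<in> K" "cmod (w - w0) < d/2" for w k
    using d(2)[OF that(1)] that(2) norm_triangle_ineq2[of "w0 - k" "w0 - w"]
    by (auto simp: dist_norm norm_minus_commute)
  have int_inv: "integrable \<nu> (\<lambda>k. 1 / (w - k))" if w: "cmod (w - w0) < d/2" for w
  proof (rule integrable_const_bound)
    show "AE k in \<nu>. norm (1 / (w - k)) \<le> 2 / d"
      using assms(4)
    proof eventually_elim
      case (elim k)
      have "1 / cmod (w - k) \<le> 1 / (d/2)"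
        using far(1)[OF elim w] d(1) by (intro divide_left_mono mult_pos_pos) auto
      then show ?case by (simp add: norm_divide)
    qed
  qed measurable
  have int_sq: "integrable \<nu> (\<lambda>k. 1 / (w0 - k)\<^sup>2)"
  proof (rule integrable_const_bound)
    show "AE k in \<nu>. norm (1 / (w0 - k)\<^sup>2) \<le> 1 / d\<^sup>2"
      using assms(4)
    proof eventually_elim
      case (elim k)
      have "1 / (cmod (w0 - k))\<^sup>2 \<le> 1 / d\<^sup>2"
        using far(2)[OF elim, of w0] d(1) by (intro divide_left_mono power_mono mult_pos_pos zero_less_power) auto
      then show ?case by (simp add: norm_divide norm_power)
    qed
  qed measurable
  have int_ln: "integrable \<nu> (\<lambda>k. ln (cmod (w - k)))" if w: "cmod (w - w0) < d/2" for w
  proof (rule integrable_const_bound)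
    show "AE k in \<nu>. norm (ln (cmod (w - k))) \<le> \<bar>ln (d/2)\<bar> + \<bar>ln (cmod w + R)\<bar>"
      using assms(4)
    proof eventually_elim
      case (elim k)
      have "cmod (w - k) \<le> cmod w + R" using norm_triangle_ineq4[of w k] R(1)[OF elim] by linarith
      then have "ln (d/2) \<le> ln (cmod (w - k))" "ln (cmod (w - k)) \<le> ln (cmod w + R)"
        using far(1)[OF elim w] d(1) by (intro ln_mono; linarith)+
      then show ?case by simp
    qed
  qed measurable
  have q1: "AE k in \<nu>. \<forall>w. cmod (w - w0) < d/2 \<longrightarrow>
      norm (1 / (w - k) - 1 / (w0 - k) - (w - w0) * (- 1 / (w0 - k)\<^sup>2)) \<le> 2 / d^3 * (cmod (w - w0))\<^sup>2"
    using assms(4)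
  proof (eventually_elim, intro allI impI)
    fix k w assume k: "k \<in> K" and w: "cmod (w - w0) < d/2"
    note f = far[OF k w]
    have nz: "w - k \<noteq> 0" "w0 - k \<noteq> 0" using f d(1) by auto
    \<comment> \<open>This is the exact remainder of the geometric series for
      \<open>1 / (w - k)\<close> after the linear term.\<close>
    have "1 / (w - k) - 1 / (w0 - k) - (w - w0) * (- 1 / (w0 - k)\<^sup>2) = (w - w0)\<^sup>2 / ((w - k) * (w0 - k)\<^sup>2)"
      using nz by (simp add: divide_simps) (simp add: power2_eq_square algebra_simps)
    also have "norm \<dots> = (cmod (w - w0))\<^sup>2 / (cmod (w - k) * (cmod (w0 - k))\<^sup>2)"
      by (simp add: norm_divide norm_mult norm_power)
    also have "\<dots> \<le> (cmod (w - w0))\<^sup>2 / (d/2 * d\<^sup>2)"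
      using f d(1) nz by (intro divide_left_mono mult_mono power_mono mult_pos_pos zero_less_power) auto
    finally show "norm (1 / (w - k) - 1 / (w0 - k) - (w - w0) * (- 1 / (w0 - k)\<^sup>2)) \<le> 2 / d^3 * (cmod (w - w0))\<^sup>2"
      by (simp add: power3_eq_cube power2_eq_square mult_ac)
  qed
  have "((\<lambda>w. \<integral>k. 1 / (w - k) \<partial>\<nu>) has_derivative (\<lambda>h. \<integral>k. h * (- 1 / (w0 - k)\<^sup>2) \<partial>\<nu>)) (at w0)"
  proof (rule has_derivative_integral_quadratic[OF \<open>finite_measure \<nu>\<close> _ _ int_inv _ _ q1])
    show "integrable \<nu> (\<lambda>k. h * (- 1 / (w0 - k)\<^sup>2))" for h
      using int_sq by (intro integrable_mult_right) simp
    show "bounded_linear (\<lambda>h. \<integral>k. h * (- 1 / (w0 - k)\<^sup>2) \<partial>\<nu>)"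
      by (simp only: integral_mult_right_zero bounded_linear_mult_left)
  qed (use d in auto)
  then show "((\<lambda>w. \<integral>k. 1 / (w - k) \<partial>\<nu>) has_field_derivative (\<integral>k. - 1 / (w0 - k)\<^sup>2 \<partial>\<nu>)) (at w0)"
    unfolding has_field_derivative_def integral_mult_right_zero by (rule has_derivative_eq_rhs) (auto simp: mult.commute)
  have q2: "AE k in \<nu>. \<forall>w. cmod (w - w0) < d/2 \<longrightarrow>
      norm (ln (cmod (w - k)) - ln (cmod (w0 - k)) - Re ((w - w0) * (1 / (w0 - k)))) \<le> 2 / d\<^sup>2 * (cmod (w - w0))\<^sup>2"
    using assms(4)
  proof (eventually_elim, intro allI impI)
    fix k w assume k: "k \<in> K" and w: "cmod (w - w0) < d/2"
    note f = far[OF k w]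
    have nz: "w - k \<noteq> 0" "w0 - k \<noteq> 0" using f d(1) by auto
    \<comment> \<open>The difference of the two logarithms is the real part of
      \<open>Ln (1 + q)\<close>, and \<open>cmod q < 1/2\<close> keeps \<open>1 + q\<close> away
      from the branch cut.\<close>
    define q where "q = (w - w0) / (w0 - k)"
    have "cmod q \<le> cmod (w - w0) / d"
      unfolding q_def norm_divide using f d(1) nz by (intro divide_left_mono) auto
    moreover have "cmod (w - w0) / d < 1/2" using w d(1) by (simp add: divide_simps)
    ultimately have q: "cmod q < 1/2" "(cmod q)\<^sup>2 \<le> (cmod (w - w0) / d)\<^sup>2"
      by (rule order_le_less_trans, intro power_mono norm_ge_zero)
    have "1 + q = (w - k) / (w0 - k)" using nz by (simp add: q_def field_simps)
    then have q1: "cmod (1 + q) = cmod (w - k) / cmod (w0 - k)" "1 + q \<noteq> 0"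
      using nz by (auto simp: norm_divide)
    then have "ln (cmod (w - k)) - ln (cmod (w0 - k)) = Re (Ln (1 + q))"
      using nz by (simp add: ln_div)
    then have "ln (cmod (w - k)) - ln (cmod (w0 - k)) - Re ((w - w0) * (1 / (w0 - k))) = Re (Ln (1 + q) - q)"
      by (simp add: q_def)
    also have "norm \<dots> \<le> cmod (Ln (1 + q) - q)" unfolding real_norm_def by (rule abs_Re_le_cmod)
    also have "\<dots> \<le> (cmod q)\<^sup>2 / (1 - cmod q)" by (rule Ln_approx_linear) (use q in simp)
    also have "\<dots> \<le> (cmod q)\<^sup>2 / (1/2)" using q by (intro divide_left_mono) auto
    also have "\<dots> \<le> 2 / d\<^sup>2 * (cmod (w - w0))\<^sup>2" using q(2) by (simp add: power_divide)
    finally show "norm (ln (cmod (w - k)) - ln (cmod (w0 - k)) - Re ((w - w0) * (1 / (w0 - k)))) \<le> 2 / d\<^sup>2 * (cmod (w - w0))\<^sup>2" .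
  qed
  have int0: "integrable \<nu> (\<lambda>k. 1 / (w0 - k))" by (rule int_inv) (use d in simp)
  have eq: "(\<integral>k. Re (h * (1 / (w0 - k))) \<partial>\<nu>) = Re (h * (\<integral>k. 1 / (w0 - k) \<partial>\<nu>))" for h
    using int0 by (subst integral_Re) (simp_all only: integrable_mult_right integral_mult_right_zero)
  have "((\<lambda>w. \<integral>k. ln (cmod (w - k)) \<partial>\<nu>) has_derivative (\<lambda>h. \<integral>k. Re (h * (1 / (w0 - k))) \<partial>\<nu>)) (at w0)"
  proof (rule has_derivative_integral_quadratic[OF \<open>finite_measure \<nu>\<close> _ _ int_ln _ _ q2])
    show "integrable \<nu> (\<lambda>k. Re (h * (1 / (w0 - k))))" for h
      using int0 by (intro integrable_Re integrable_mult_right)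
    show "bounded_linear (\<lambda>h. \<integral>k. Re (h * (1 / (w0 - k))) \<partial>\<nu>)"
      unfolding eq by (intro bounded_linear_compose[OF bounded_linear_Re bounded_linear_mult_left])
  qed (use d in auto)
  then show "((\<lambda>w. \<integral>k. ln (cmod (w - k)) \<partial>\<nu>) has_derivative (\<lambda>h. Re (h * (\<integral>k. 1 / (w0 - k) \<partial>\<nu>)))) (at w0)"
    unfolding eq .
qed

text \<open>By the chain rule the potential composed with \<open>g\<close> has differential
  \<open>Re (deriv g z * C (g z) * h)\<close>, with \<open>C\<close> the Cauchy transform. On a
  convex set this holomorphic coefficient has a primitive \<open>G\<close>, whose real part differs
  from the composed potential by a constant.\<close>

lemma holomorphic_log_potential:
  assumes \<nu>: "finite_measure \<nu>" "sets \<nu> = sets borel" "compact K" "AE k in \<nu>. k \<in> K"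
    and U: "open U" "convex U" and g: "g holomorphic_on U" "g ` U \<inter> K = {}"
  obtains F where "F holomorphic_on U" "\<And>z. z \<in> U \<Longrightarrow> Re (F z) = (\<integral>k. ln (cmod (g z - k)) \<partial>\<nu>)"
proof -
  define C where "C w = (\<integral>k. 1 / (w - k) \<partial>\<nu>)" for w
  define P where "P w = (\<integral>k. ln (cmod (w - k)) \<partial>\<nu>)" for w
  have gK: "g z \<notin> K" if "z \<in> U" for z using g that by auto
  have "C holomorphic_on - K"
    unfolding C_def using cauchy_transform_has_field_derivative[OF \<nu>] compact_imp_closed[OF \<nu>(3)]
    by (subst holomorphic_on_open) auto
  then have "C \<circ> g holomorphic_on U"
    using g by (intro holomorphic_on_compose_gen) auto
  then have "(\<lambda>z. deriv g z * C (g z)) holomorphic_on U"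
    using g U by (auto simp: o_def intro!: holomorphic_intros holomorphic_deriv)
  then obtain G where G: "\<And>z. z \<in> U \<Longrightarrow> (G has_field_derivative deriv g z * C (g z)) (at z within U)"
    using holomorphic_convex_primitive'[OF U(2,1)] by blast
  have "((\<lambda>z. P (g z) - Re (G z)) has_derivative (\<lambda>h. 0)) (at z within U)" if z: "z \<in> U" for z
  proof -
    have "(g has_derivative (*) (deriv g z)) (at z within U)"
      using holomorphic_derivI[OF g(1) U(1) z, of U] by (simp add: has_field_derivative_def)
    from diff_chain_within[OF this has_derivative_at_withinI[OF log_potential_has_derivative[OF \<nu> gK[OF z]]]]
    have 1: "((\<lambda>z. P (g z)) has_derivative (\<lambda>h. Re (deriv g z * h * C (g z)))) (at z within U)"
      by (simp add: P_def C_def o_def)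
    have 2: "((\<lambda>z. Re (G z)) has_derivative (\<lambda>h. Re (deriv g z * C (g z) * h))) (at z within U)"
      using G[OF z] unfolding has_field_derivative_def by (rule has_derivative_Re)
    show ?thesis
      using has_derivative_diff[OF 1 2] by (simp add: mult_ac)
  qed
  then have "\<exists>c. \<forall>z\<in>U. P (g z) - Re (G z) = c"
    by (rule has_derivative_zero_constant[OF U(2)])
  then obtain c where c: "\<And>z. z \<in> U \<Longrightarrow> P (g z) - Re (G z) = c" by blast
  show thesis
  proof
    have "G holomorphic_on U"
      using G unfolding holomorphic_on_def field_differentiable_def by blast
    then show "(\<lambda>z. G z + of_real c) holomorphic_on U" by (intro holomorphic_intros)
    show "Re (G z + of_real c) = (\<integral>k. ln (cmod (g z - k)) \<partial>\<nu>)" if "z \<in> U" for z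
      using c[OF that] unfolding P_def by simp
  qed
qed

subsection \<open>Positive harmonic functions near a boundary segment\<close>

text \<open>The Cayley-type quotient \<open>(B - A) / (B + cnj A)\<close> maps the right half-plane
  into the unit disc and sends \<open>A\<close> to 0. The Schwarz lemma bounds it by 1/2 on the
  half-radius disc, which gives the constant 1/3.\<close>

lemma harnack_lower_bound:
  fixes F :: "complex \<Rightarrow> complex"
  assumes hol: "F holomorphic_on ball a \<rho>" and "\<rho> > 0"
    and pos: "\<And>z. z \<in> ball a \<rho> \<Longrightarrow> Re (F z) > 0"
    and z: "cmod (z - a) \<le> \<rho> / 2"
  shows "Re (F z) \<ge> Re (F a) / 3"
proof -
  define A where "A = F a"
  have A: "Re A > 0" using pos[of a] \<open>\<rho> > 0\<close> by (simp add: A_def)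
  define G where "G w = (F (a + of_real \<rho> * w) - A) / (F (a + of_real \<rho> * w) + cnj A)" for w
  have inb: "a + of_real \<rho> * w \<in> ball a \<rho>" if "cmod w < 1" for w :: complex
    using that \<open>\<rho> > 0\<close> by (simp add: dist_norm norm_mult)
  have holF: "(\<lambda>w. F (a + of_real \<rho> * w)) holomorphic_on ball 0 1"
    by (rule holomorphic_on_compose_gen[OF _ hol, of "\<lambda>w. a + of_real \<rho> * w", unfolded o_def])
      (use inb in \<open>auto intro!: holomorphic_intros\<close>)
  have nz: "F (a + of_real \<rho> * w) + cnj A \<noteq> 0" if "cmod w < 1" for w :: complex
  proof
    assume "F (a + of_real \<rho> * w) + cnj A = 0"
    then have "Re (F (a + of_real \<rho> * w) + cnj A) = 0" by simp
    with pos[OF inb[OF that]] A show False by simp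
  qed
  have "cmod (G w) < 1" if w: "cmod w < 1" for w
  proof -
    define B where "B = F (a + of_real \<rho> * w)"
    have "Re B > 0" using pos[OF inb[OF w]] by (simp add: B_def)
    then have "(Re B - Re A)\<^sup>2 < (Re B + Re A)\<^sup>2"
      using A by (simp add: power2_eq_square algebra_simps)
    then have "(cmod (B - A))\<^sup>2 < (cmod (B + cnj A))\<^sup>2"
      by (simp add: cmod_power2)
    then have "cmod (B - A) < cmod (B + cnj A)"
      by (rule power2_less_imp_less) simp
    then show ?thesis
      using nz[OF w] by (simp add: G_def B_def norm_divide)
  qed
  moreover have "G holomorphic_on ball 0 1"
    unfolding G_def using nz by (intro holomorphic_intros holF) auto
  moreover have "G 0 = 0" by (simp add: G_def A_def)
  moreover define w where "w = (z - a) / \<rho>"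
  have w: "cmod w \<le> 1/2" using z \<open>\<rho> > 0\<close> by (simp add: w_def norm_divide field_simps)
  ultimately have "cmod (G w) \<le> cmod w"
    by (intro Schwarz_Lemma) auto
  with w have G: "cmod (G w) \<le> 1/2" by simp
  define B where "B = F z"
  have az: "a + of_real \<rho> * w = z" using \<open>\<rho> > 0\<close> by (simp add: w_def)
  have B: "Re B > 0" using pos[OF inb[of w]] w by (simp add: az B_def)
  have "B + cnj A \<noteq> 0" using nz[of w] w by (simp add: az B_def)
  with G have "2 * cmod (B - A) \<le> cmod (B + cnj A)"
    unfolding G_def az B_def[symmetric] by (simp add: norm_divide field_simps)
  then have "(2 * cmod (B - A))\<^sup>2 \<le> (cmod (B + cnj A))\<^sup>2"
    by (rule power_mono) simp
  then have "4 * ((Re B - Re A)\<^sup>2 + (Im B - Im A)\<^sup>2) \<le> (Re B + Re A)\<^sup>2 + (Im B - Im A)\<^sup>2"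
    by (simp add: power_mult_distrib cmod_power2)
  moreover have "(Im B - Im A)\<^sup>2 \<ge> 0" by simp
  moreover have "4 * p \<le> r" if "4 * (p + q) \<le> r + q" "0 \<le> q" for p q r :: real
    using that by simp
  ultimately have "4 * (Re B - Re A)\<^sup>2 \<le> (Re B + Re A)\<^sup>2" by blast
  then have "(2 * (Re A - Re B))\<^sup>2 \<le> (Re B + Re A)\<^sup>2"
    unfolding power_mult_distrib by (simp add: power2_commute[of "Re A" "Re B"])
  then have "2 * (Re A - Re B) \<le> Re B + Re A"
    by (rule power2_le_imp_le) (use A B in simp)
  then show ?thesis by (simp add: A_def B_def)
qed

text \<open>The logarithm of the modulus is the Green function of the upper half of the
  unit disc with pole at \<open>a\<close>: the pole is reflected in the real line and in the circle.\<close>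
definition green_quotient :: "complex \<Rightarrow> complex \<Rightarrow> complex" where
  "green_quotient a z = ((z - cnj a) * (1 - cnj a * z)) / ((z - a) * (1 - a * z))"

text \<open>Conjugation preserves a real \<open>z\<close> and exchanges the factors of numerator and
  denominator. The bound is an inequality because the quotient has the value 0 where the denominator
  vanishes.\<close>

lemma cmod_green_quotient_real:
  assumes "Im z = 0"
  shows "cmod (green_quotient a z) \<le> 1"
proof -
  have "z = cnj z" using assms by (simp add: complex_eq_iff)
  then have "cmod (z - cnj a) = cmod (z - a)" "cmod (1 - cnj a * z) = cmod (1 - a * z)"
    by (metis complex_cnj_diff complex_mod_cnj, metis complex_cnj_diff complex_cnj_mult complex_cnj_one complex_mod_cnj)
  then show ?thesis
    by (simp add: green_quotient_def norm_divide norm_mult)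
qed

text \<open>On the unit circle \<open>1 - b * z\<close> and \<open>z - cnj b\<close> have equal
  modulus, so each factor of the numerator matches the opposite factor of the denominator.\<close>

lemma cmod_green_quotient_circle:
  assumes "cmod z = 1"
  shows "cmod (green_quotient a z) \<le> 1"
proof -
  have zz: "z * cnj z = 1" using assms by (simp add: complex_mult_cnj cmod_power2 flip: cmod_power2)
  have *: "cmod (1 - b * z) = cmod (z - cnj b)" for b
  proof -
    have "1 - b * z = z * cnj (z - cnj b)" using zz by (simp add: algebra_simps)
    then show ?thesis using assms by (metis complex_mod_cnj mult_1 norm_mult)
  qed
  show ?thesis
    using *[of a] *[of "cnj a"] by (simp add: green_quotient_def norm_divide norm_mult)
qed

text \<open>The factor reflected in the circle is at most 1, which leaves the Green function of the
  half-plane; that one is estimated by \<open>1 + x \<le> exp x\<close>.\<close>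

lemma cmod_green_quotient_upper:
  assumes "Im z \<ge> 0" "Im a > 0" "z \<noteq> a"
  shows "cmod (green_quotient a z) \<le> exp (2 * Im z * Im a / (cmod (z - a))\<^sup>2)"
proof -
  have d: "(cmod (z - a))\<^sup>2 > 0" using assms by simp
  have "(cmod (1 - cnj a * z))\<^sup>2 \<le> (cmod (1 - a * z))\<^sup>2"
    using mult_nonneg_nonneg[of "Im z" "Im a"] assms unfolding cmod_power2
    by (simp add: power2_eq_square algebra_simps)
  then have 1: "cmod (1 - cnj a * z) \<le> cmod (1 - a * z)"
    by (rule power2_le_imp_le) simp
  have "(cmod (z - cnj a))\<^sup>2 = (cmod (z - a))\<^sup>2 + 4 * Im z * Im a"
    unfolding cmod_power2 by (simp add: power2_eq_square algebra_simps)
  then have "(cmod (z - cnj a) / cmod (z - a))\<^sup>2 = 1 + 2 * (2 * Im z * Im a / (cmod (z - a))\<^sup>2)"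
    using d by (simp add: power_divide add_divide_distrib)
  also have "\<dots> \<le> exp (2 * (2 * Im z * Im a / (cmod (z - a))\<^sup>2))"
    by (rule exp_ge_add_one_self)
  also have "\<dots> = (exp (2 * Im z * Im a / (cmod (z - a))\<^sup>2))\<^sup>2"
    by (rule exp_double)
  finally have 2: "cmod (z - cnj a) / cmod (z - a) \<le> exp (2 * Im z * Im a / (cmod (z - a))\<^sup>2)"
    by (rule power2_le_imp_le) simp
  have "cmod (green_quotient a z) = (cmod (z - cnj a) / cmod (z - a)) * (cmod (1 - cnj a * z) / cmod (1 - a * z))"
    by (simp add: green_quotient_def norm_divide norm_mult)
  also have "\<dots> \<le> (cmod (z - cnj a) / cmod (z - a)) * 1"
    by (rule mult_left_mono) (use 1 in \<open>auto simp: divide_le_eq_1\<close>)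
  finally show ?thesis using 2 by simp
qed

text \<open>At the fixed point \<open>\<i>/2\<close> the Green function is bounded below by a
  multiple of the height of the pole. In the proof, conjugating \<open>a\<close> changes the squared
  moduli \<open>A\<close> and \<open>B\<close> by \<open>2 * h\<close>; this gains more in the first
  factor than it loses in the second because \<open>A\<close> is much smaller than
  \<open>B\<close>.\<close>

lemma cmod_green_quotient_lower:
  assumes a: "\<bar>Re a\<bar> \<le> 1/4" "0 < Im a" "Im a \<le> 1/8"
  shows "cmod (green_quotient a (\<i>/2)) \<ge> exp (Im a / 2)"
proof -
  define x h where "x = Re a" and "h = Im a"
  have xh: "x\<^sup>2 \<le> 1/16" "0 < h" "h \<le> 1/8" "0 \<le> x\<^sup>2"
    using a power_mono[of "\<bar>x\<bar>" "1/4" 2] by (auto simp: x_def h_def power2_eq_square)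
  define A B where "A = x\<^sup>2 + (1/2 - h)\<^sup>2" and "B = (1 - h/2)\<^sup>2 + x\<^sup>2 / 4"
  have n: "(cmod (\<i>/2 - a))\<^sup>2 = A" "(cmod (\<i>/2 - cnj a))\<^sup>2 = A + 2 * h"
    "(cmod (1 - cnj a * (\<i>/2)))\<^sup>2 = B" "(cmod (1 - a * (\<i>/2)))\<^sup>2 = B + 2 * h"
    unfolding cmod_power2 A_def B_def x_def h_def by (simp_all add: power2_eq_square field_simps)
  have "(1/2 - h)\<^sup>2 \<le> (1/2)\<^sup>2" "(3/8)\<^sup>2 \<le> (1/2 - h)\<^sup>2" "(15/16)\<^sup>2 \<le> (1 - h/2)\<^sup>2"
    using xh by (intro power_mono; simp)+
  then have AB: "0 < A" "A \<le> 5/16" "225/256 \<le> B"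
    using xh unfolding A_def B_def by (simp_all add: power_divide, linarith+)
  have "(1 + h + h\<^sup>2) * (A * (B + 2 * h)) \<le> (A + 2 * h) * B"
  proof -
    have "h\<^sup>2 \<le> h / 8" using xh by (simp add: power2_eq_square)
    then have "(1 + h + h\<^sup>2) * (A * (B + 2 * h)) \<le> (1 + 9/8 * h) * (A * (B + 2 * h))"
      using AB xh by (intro mult_right_mono) auto
    also have "\<dots> = A * B + h * (A * (9/8 * B + 2 + 9/4 * h))" by (simp add: algebra_simps)
    also have "\<dots> \<le> A * B + h * (2 * B)"
    proof -
      have "A * (9/8 * B + 2 + 9/4 * h) \<le> 5/16 * (9/8 * B + 2 + 9/4 * h)"
        using AB xh by (intro mult_right_mono) auto
      also have "\<dots> \<le> 2 * B" using AB xh by simp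
      finally show ?thesis using xh by (simp add: mult_left_mono)
    qed
    finally show ?thesis by (simp add: algebra_simps)
  qed
  moreover have "exp h \<le> 1 + h + h\<^sup>2"
    using exp_bound[of h] xh by simp
  ultimately have "exp h * (A * (B + 2 * h)) \<le> (A + 2 * h) * B"
    using AB xh by (intro order_trans[OF mult_right_mono[of "exp h" "1 + h + h\<^sup>2" "A * (B + 2 * h)"]]) auto
  then have "exp h \<le> (A + 2 * h) * B / (A * (B + 2 * h))"
    using AB xh by (simp add: pos_le_divide_eq)
  also have "\<dots> = (cmod (green_quotient a (\<i>/2)))\<^sup>2"
    by (simp add: green_quotient_def norm_divide norm_mult power_divide power_mult_distrib n del: times_divide_eq_right)
  finally have "(exp (h/2))\<^sup>2 \<le> (cmod (green_quotient a (\<i>/2)))\<^sup>2"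
    by (simp flip: exp_double)
  then show ?thesis unfolding h_def by (rule power2_le_imp_le) simp
qed

text \<open>The intervals of radius \<open>h a\<close> about \<open>x a\<close> are disjoint, and their images under
  \<open>t \<mapsto> arctan ((t - x b) / h b)\<close> are disjoint subintervals of an interval of length \<open>pi\<close>.\<close>
lemma separated_sum_le:
  fixes x h :: "'a \<Rightarrow> real"
  assumes fin: "finite S" and h: "\<And>a. a \<in> S \<Longrightarrow> h a > 0"
    and sep: "\<And>a b. a \<in> S \<Longrightarrow> b \<in> S \<Longrightarrow> a \<noteq> b \<Longrightarrow> \<bar>x a - x b\<bar> \<ge> 2 * (h a + h b)"
    and b: "b \<in> S"
  shows "(\<Sum>a\<in>S - {b}. h a * h b / (x a - x b)\<^sup>2) \<le> 5"
proof -
  define l u where "l a = arctan ((x a - h a - x b) / h b)" and "u a = arctan ((x a + h a - x b) / h b)" for a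
  let ?J = "\<lambda>a. {l a<..<u a}"
  have hb: "h b > 0" using h b by auto
  have ul: "h a * h b / (x a - x b)\<^sup>2 \<le> 5/4 * (u a - l a)" and lu: "l a \<le> u a" if a: "a \<in> S - {b}" for a
  proof -
    have ha: "h a > 0" using h a by auto
    define p q where "p = (x a - h a - x b) / h b" and "q = (x a + h a - x b) / h b"
    have pq: "p < q" "q - p = 2 * h a / h b" using ha hb by (auto simp: p_def q_def divide_simps)
    \<comment> \<open>The density \<open>inverse (1 + \<xi>\<^sup>2)\<close> of the image interval
      is, up to scaling, the Poisson kernel of the half-plane at height \<open>h b\<close> above
      \<open>x b\<close>.\<close>
    obtain \<xi> where \<xi>: "p < \<xi>" "\<xi> < q" "arctan q - arctan p = (q - p) * inverse (1 + \<xi>\<^sup>2)"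
      using MVT2[OF pq(1), of arctan "\<lambda>t. inverse (1 + t\<^sup>2)"] DERIV_arctan by auto
    define D where "D = \<bar>x a - x b\<bar>"
    have D: "D \<ge> 2 * h a + 2 * h b" using sep[of a b] a b by (auto simp: D_def)
    have "\<bar>\<xi>\<bar> \<le> (3/2 * D) / h b"
    proof -
      have "q \<le> (3/2 * D) / h b" "- (3/2 * D) / h b \<le> p"
      proof -
        have "x a - x b \<le> D" "- D \<le> x a - x b" by (auto simp: D_def)
        then have "x a + h a - x b \<le> 3/2 * D" "- (3/2 * D) \<le> x a - h a - x b"
          using hb ha D by auto
        then show "q \<le> (3/2 * D) / h b" "- (3/2 * D) / h b \<le> p"
          unfolding p_def q_def using hb by (intro divide_right_mono; simp)+
      qed
      then show ?thesis using \<xi> by (auto simp: abs_if)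
    qed
    then have "\<xi>\<^sup>2 \<le> ((3/2 * D) / h b)\<^sup>2" by (metis abs_ge_zero power2_abs power_mono)
    \<comment> \<open>The constant 5/2 below is 9/4 from the bound on \<open>\<xi>\<close> plus 1/4
      from this estimate of 1.\<close>
    moreover have "1 \<le> (D / (2 * h b))\<^sup>2" using D ha hb by (simp add: one_le_power pos_le_divide_eq)
    ultimately have "1 + \<xi>\<^sup>2 \<le> 5/2 * D\<^sup>2 / (h b)\<^sup>2"
      by (simp add: power_divide power_mult_distrib)
    then have "(h b)\<^sup>2 * (1 + \<xi>\<^sup>2) \<le> 5/2 * D\<^sup>2"
      using hb by (simp add: field_simps)
    moreover have D0: "D > 0" using D ha hb by linarith
    moreover have x0: "1 + \<xi>\<^sup>2 > 0" by (simp add: add_pos_nonneg)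
    ultimately have "h b / D\<^sup>2 \<le> 5/2 / (h b * (1 + \<xi>\<^sup>2))"
      using hb by (simp add: divide_simps power2_eq_square mult_ac)
    then have "h a * (h b / D\<^sup>2) \<le> h a * (5/2 / (h b * (1 + \<xi>\<^sup>2)))"
      using ha by (intro mult_left_mono) auto
    also have "\<dots> = 5/4 * (arctan q - arctan p)"
      using \<xi>(3) pq hb x0 by (simp add: field_simps)
    finally show "h a * h b / (x a - x b)\<^sup>2 \<le> 5/4 * (u a - l a)"
      by (simp add: D_def u_def l_def p_def q_def)
    show "l a \<le> u a"
      using pq(1) by (simp add: l_def u_def p_def q_def arctan_le_iff)
  qed
  have "(\<Sum>a\<in>S - {b}. u a - l a) = (\<Sum>a\<in>S - {b}. measure lebesgue (?J a))"
    using lu by (intro sum.cong) auto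
  also have "\<dots> = measure lebesgue (\<Union>a\<in>S - {b}. ?J a)"
  proof (rule measure_UNION'[symmetric])
    show "pairwise (\<lambda>i j. disjnt (?J i) (?J j)) (S - {b})"
    proof (rule pairwiseI)
      fix i j assume ij: "i \<in> S - {b}" "j \<in> S - {b}" "i \<noteq> j"
      then have "h i > 0" "h j > 0" "2 * (h i + h j) \<le> \<bar>x i - x j\<bar>"
        using h sep[of i j] by auto
      then have "x i + h i \<le> x j - h j \<or> x j + h j \<le> x i - h i" by argo
      then have "u i \<le> l j \<or> u j \<le> l i"
        using hb by (auto simp: u_def l_def arctan_le_iff intro!: divide_right_mono)
      then show "disjnt (?J i) (?J j)" by (auto simp: disjnt_def)
    qed
  qed (use fin in auto)
  also have "\<dots> \<le> measure lebesgue {-pi/2<..<pi/2}"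
  proof (rule measure_mono_fmeasurable)
    show "(\<Union>a\<in>S - {b}. ?J a) \<subseteq> {-pi/2<..<pi/2}"
      using arctan_bounded unfolding l_def u_def
      by (auto simp: dest: less_trans) (smt (verit) arctan_bounded)+
  qed (use fin in auto)
  also have "\<dots> = pi" by simp
  finally have "(\<Sum>a\<in>S - {b}. u a - l a) \<le> pi" .
  moreover have "(\<Sum>a\<in>S - {b}. h a * h b / (x a - x b)\<^sup>2) \<le> (\<Sum>a\<in>S - {b}. 5/4 * (u a - l a))"
    by (rule sum_mono) (rule ul)
  ultimately show ?thesis
    using pi_less_4 unfolding sum_distrib_left[symmetric] by simp
qed

text \<open>The logarithm of \<open>cmod (\<Phi> z)\<close> is the sum of the Green functions minus
  \<open>120 / N\<close> times the real part of \<open>F\<close>. Comparing the two harmonic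
  functions thus becomes the maximum modulus principle for \<open>\<Phi>\<close> on the half-disc
  with discs about the poles removed.\<close>

lemma green_comparison:
  fixes F :: "complex \<Rightarrow> complex"
  defines "H \<equiv> {z. cmod z < 1 \<and> Im z > 0}" and "H' \<equiv> {z. cmod z \<le> 1 \<and> Im z \<ge> 0}"
  assumes hol: "F holomorphic_on H" and cont: "continuous_on H' F"
    and pos: "\<And>z. z \<in> H' \<Longrightarrow> Re (F z) > 0"
    and fin: "finite S" and S: "\<And>a. a \<in> S \<Longrightarrow> \<bar>Re a\<bar> \<le> 1/4 \<and> 0 < Im a \<and> Im a \<le> 1/8"
    and sep: "\<And>a b. a \<in> S \<Longrightarrow> b \<in> S \<Longrightarrow> a \<noteq> b \<Longrightarrow> \<bar>Re a - Re b\<bar> \<ge> 2 * (Im a + Im b)"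
    and "N > 0" and N: "\<And>a. a \<in> S \<Longrightarrow> Re (F a) \<ge> N"
  shows "(\<Sum>a\<in>S. Im a) \<le> 240 * Re (F (\<i>/2)) / N"
proof -
  \<comment> \<open>The factor \<open>120 / N\<close> is chosen so that the Harnack bound
    \<open>N / 3\<close> gives 40 on the circles about the poles, which outweighs the sum of the
    Green functions there.\<close>
  define \<Phi> where "\<Phi> z = exp (- (of_real (120 / N) * F z)) * (\<Prod>a\<in>S. green_quotient a z)" for z
  define B where "B = (\<Union>a\<in>S. cball a (Im a / 2))"
  have norm_\<Phi>: "cmod (\<Phi> z) = exp (- (120 / N * Re (F z))) * (\<Prod>a\<in>S. cmod (green_quotient a z))" for z
    by (simp add: \<Phi>_def norm_mult prod_norm del: of_real_divide)
  have ballH: "ball a (Im a) \<subseteq> H" if "a \<in> S" for a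
  proof
    fix z assume z: "z \<in> ball a (Im a)"
    then have d: "cmod (z - a) < Im a" by (simp add: dist_norm norm_minus_commute)
    then have "Im z > 0" using abs_Im_le_cmod[of "z - a"] by (simp add: abs_if split: if_splits)
    moreover have "cmod a \<le> \<bar>Re a\<bar> + \<bar>Im a\<bar>" by (rule cmod_le)
    then have "cmod z < 1"
      using d S[OF that] norm_triangle_sub[of z a] by linarith
    ultimately show "z \<in> H" by (simp add: H_def)
  qed
  have harnack: "Re (F z) \<ge> N / 3" if "a \<in> S" "cmod (z - a) \<le> Im a / 2" for a z
  proof -
    have "Re (F z) \<ge> Re (F a) / 3"
    proof (rule harnack_lower_bound[where F = F and a = a and z = z and \<rho> = "Im a"])
      show "F holomorphic_on ball a (Im a)" using hol ballH that holomorphic_on_subset by blast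
      show "0 < Re (F w)" if "w \<in> ball a (Im a)" for w
        using ballH[OF \<open>a \<in> S\<close>] that by (intro pos) (auto simp: H_def H'_def)
    qed (use that S in auto)
    with N[OF that(1)] show ?thesis by simp
  qed
  \<comment> \<open>The pole \<open>b\<close> itself contributes at most 12 and the others at most
    \<open>16/3 * 5\<close>, which together stay below 40.\<close>
  have green_sum: "(\<Sum>a\<in>S. 2 * Im z * Im a / (cmod (z - a))\<^sup>2) \<le> 40"
    if b: "b \<in> S" and z: "cmod (z - b) = Im b / 2" for b z
  proof -
    have hb: "0 < Im b" using S[OF b] by simp
    have Rez: "\<bar>Re z - Re b\<bar> \<le> Im b / 2" and "\<bar>Im z - Im b\<bar> \<le> Im b / 2"
      using abs_Im_le_cmod[of "z - b"] abs_Re_le_cmod[of "z - b"] z by auto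
    then have Imz: "0 \<le> Im z" "Im z \<le> 3/2 * Im b" using hb unfolding abs_le_iff by auto
    have self: "2 * Im z * Im b / (cmod (z - b))\<^sup>2 \<le> 12"
      using Imz hb unfolding z by (simp add: power2_eq_square field_simps)
    have "2 * Im z * Im a / (cmod (z - a))\<^sup>2 \<le> 16/3 * (Im a * Im b / (Re a - Re b)\<^sup>2)"
      if a: "a \<in> S - {b}" for a
    proof -
      define D where "D = \<bar>Re a - Re b\<bar>"
      have D: "D \<ge> 2 * Im a + 2 * Im b" using sep[of a b] a b by (auto simp: D_def)
      have ha: "Im a > 0" using S a by auto
      \<comment> \<open>Moving from \<open>b\<close> to \<open>z\<close> shifts the real part by at
        most \<open>Im b / 2\<close>, which is at most \<open>D / 4\<close> by the
        separation.\<close>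
      have "3/4 * D \<le> \<bar>Re z - Re a\<bar>" using D ha hb Rez unfolding D_def by argo
      also have "\<dots> \<le> cmod (z - a)" using abs_Re_le_cmod[of "z - a"] by simp
      finally have Dz: "3/4 * D \<le> cmod (z - a)" .
      then have "(3/4 * D)\<^sup>2 \<le> (cmod (z - a))\<^sup>2" using D ha hb by (intro power_mono) auto
      moreover have "0 < D" using D ha hb by linarith
      ultimately have "2 * Im z * Im a / (cmod (z - a))\<^sup>2 \<le> 2 * Im z * Im a / (3/4 * D)\<^sup>2"
        using Imz ha Dz by (intro divide_left_mono mult_pos_pos zero_less_power) auto
      also have "\<dots> \<le> 2 * (3/2 * Im b) * Im a / (3/4 * D)\<^sup>2"
        using Imz ha by (intro divide_right_mono mult_right_mono mult_left_mono) auto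
      also have "\<dots> = 16/3 * (Im a * Im b / D\<^sup>2)"
        by (simp add: power_mult_distrib power_divide)
      finally show ?thesis by (simp add: D_def)
    qed
    then have "(\<Sum>a\<in>S - {b}. 2 * Im z * Im a / (cmod (z - a))\<^sup>2)
        \<le> (\<Sum>a\<in>S - {b}. 16/3 * (Im a * Im b / (Re a - Re b)\<^sup>2))"
      by (rule sum_mono)
    also have "\<dots> = 16/3 * (\<Sum>a\<in>S - {b}. Im a * Im b / (Re a - Re b)\<^sup>2)"
      by (rule sum_distrib_left[symmetric])
    also have "\<dots> \<le> 16/3 * 5"
      by (intro mult_left_mono separated_sum_le) (use fin S sep b in auto)
    finally show ?thesis
      using self by (subst sum.remove[OF fin b]) simp
  qed
  have sphere: "cmod (\<Phi> z) \<le> 1" if b: "b \<in> S" and z: "cmod (z - b) = Im b / 2"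
      and out: "\<And>a. a \<in> S \<Longrightarrow> cmod (z - a) \<ge> Im a / 2" for b z
  proof -
    have "\<bar>Im z - Im b\<bar> \<le> Im b / 2" using abs_Im_le_cmod[of "z - b"] z by simp
    then have "0 \<le> Im z" using S[OF b] unfolding abs_le_iff by auto
    moreover have "z \<noteq> a" if "a \<in> S" for a using out[OF that] S[OF that] by auto
    ultimately have "(\<Prod>a\<in>S. cmod (green_quotient a z)) \<le> (\<Prod>a\<in>S. exp (2 * Im z * Im a / (cmod (z - a))\<^sup>2))"
      using S by (intro prod_mono conjI cmod_green_quotient_upper) auto
    also have "\<dots> = exp (\<Sum>a\<in>S. 2 * Im z * Im a / (cmod (z - a))\<^sup>2)"
      by (rule exp_sum[OF fin, symmetric])
    also have "\<dots> \<le> exp 40" using green_sum[OF b z] by simp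
    finally have "(\<Prod>a\<in>S. cmod (green_quotient a z)) \<le> exp 40" .
    moreover have "exp (- (120 / N * Re (F z))) \<le> exp (-40)"
      using harnack[OF b, of z] z \<open>N > 0\<close> by (simp add: field_simps)
    ultimately have "cmod (\<Phi> z) \<le> exp (-40) * exp 40"
      unfolding norm_\<Phi> by (intro mult_mono) (auto intro: prod_nonneg)
    then show ?thesis by (simp flip: exp_add)
  qed
  have boundary: "cmod (\<Phi> z) \<le> 1" if z: "z \<in> H'" "Im z = 0 \<or> cmod z = 1" for z
  proof -
    have "(\<Prod>a\<in>S. cmod (green_quotient a z)) \<le> 1"
      using z(2) cmod_green_quotient_real cmod_green_quotient_circle by (intro prod_le_1) auto
    moreover have "exp (- (120 / N * Re (F z))) \<le> 1"
      using pos[OF z(1)] \<open>N > 0\<close> by simp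
    ultimately show ?thesis
      unfolding norm_\<Phi> by (intro mult_le_one) (auto intro: prod_nonneg)
  qed
  have "closed B" unfolding B_def using fin by auto
  have "open H" unfolding H_def
    by (intro open_Collect_conj open_Collect_less continuous_intros)
  have "closed H'" unfolding H'_def
    by (intro closed_Collect_conj closed_Collect_le continuous_intros)
  have "open (H - B)" using \<open>open H\<close> \<open>closed B\<close> by blast
  have cl: "closure (H - B) \<subseteq> H' \<inter> {z. \<forall>a\<in>S. cmod (z - a) \<ge> Im a / 2}"
  proof (rule closure_minimal)
    have "{z. \<forall>a\<in>S. cmod (z - a) \<ge> Im a / 2} = (\<Inter>a\<in>S. {z. Im a / 2 \<le> cmod (z - a)})" by auto
    also have "closed \<dots>" by (intro closed_INT ballI closed_Collect_le continuous_intros)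
    finally show "closed (H' \<inter> {z. \<forall>a\<in>S. cmod (z - a) \<ge> Im a / 2})" using \<open>closed H'\<close> by blast
    show "H - B \<subseteq> H' \<inter> {z. \<forall>a\<in>S. cmod (z - a) \<ge> Im a / 2}"
      by (fastforce simp: H_def H'_def B_def dist_norm norm_minus_commute)
  qed
  have denom: "(z - a) * (1 - a * z) \<noteq> 0"
    if "z \<in> H'" "cmod (z - a) \<ge> Im a / 2" "a \<in> S" for a z
  proof -
    have "cmod (a * z) < 1"
    proof -
      have "cmod a < 1" using cmod_le[of a] S[OF that(3)] by linarith
      moreover have "cmod z \<le> 1" using that by (simp add: H'_def)
      ultimately show ?thesis
        by (metis mult.right_neutral mult_left_mono norm_ge_zero norm_mult order.strict_trans1)
    qed
    then have "1 - a * z \<noteq> 0" by auto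
    moreover have "z - a \<noteq> 0" using S[OF that(3)] that by auto
    ultimately show ?thesis by simp
  qed
  have "norm (\<Phi> (\<i>/2)) \<le> 1"
  \<comment> \<open>A frontier point lies on the real segment, on the unit circle, or on one of the
    circles about the poles; \<open>boundary\<close> and \<open>sphere\<close> cover these
    cases.\<close>
  proof (rule maximum_modulus_frontier[where f = \<Phi> and S = "H - B"])
    show "\<Phi> holomorphic_on interior (H - B)"
      unfolding interior_open[OF \<open>open (H - B)\<close>] \<Phi>_def green_quotient_def
      using cl closure_subset[of "H - B"]
      by (intro holomorphic_intros holomorphic_on_subset[OF hol] denom) auto
    show "continuous_on (closure (H - B)) \<Phi>"
      unfolding \<Phi>_def green_quotient_def
      using cl by (intro continuous_intros continuous_on_subset[OF cont] ballI denom) auto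
    show "bounded (H - B)"
      by (rule bounded_subset[OF bounded_ball[of 0 1]]) (auto simp: H_def)
    show "norm (\<Phi> z) \<le> 1" if "z \<in> frontier (H - B)" for z
    proof -
      have z: "z \<in> H'" "\<And>a. a \<in> S \<Longrightarrow> cmod (z - a) \<ge> Im a / 2" "z \<notin> H - B"
        using that cl \<open>open (H - B)\<close> by (auto simp: frontier_def interior_open)
      then consider "z \<notin> H" | b where "b \<in> S" "cmod (z - b) \<le> Im b / 2"
        by (auto simp: B_def dist_norm norm_minus_commute)
      then show ?thesis
      proof cases
        case 1
        with z have "Im z = 0 \<or> cmod z = 1" by (auto simp: H_def H'_def)
        with z show ?thesis by (intro boundary)
      next
        case 2
        with z show ?thesis by (intro sphere) (auto intro: antisym)
      qed
    qed
    \<comment> \<open>The removed discs reach at most the height 3/16.\<close>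
    have "\<i>/2 \<notin> cball a (Im a / 2)" if "a \<in> S" for a
      using abs_Im_le_cmod[of "a - \<i>/2"] S[OF that] by (auto simp: dist_norm)
    then show "\<i>/2 \<in> H - B" by (auto simp: H_def B_def norm_divide)
  qed
  \<comment> \<open>Each pole contributes at least half its height at \<open>\<i>/2\<close>; this
    1/2 turns 120 into the final constant 240.\<close>
  moreover have "exp ((\<Sum>a\<in>S. Im a) / 2) \<le> (\<Prod>a\<in>S. cmod (green_quotient a (\<i>/2)))"
    unfolding sum_divide_distrib exp_sum[OF fin]
    using S by (intro prod_mono) (auto intro: cmod_green_quotient_lower)
  ultimately have "exp (- (120 / N * Re (F (\<i>/2)))) * exp ((\<Sum>a\<in>S. Im a) / 2) \<le> 1"
    unfolding norm_\<Phi> by (meson exp_ge_zero mult_left_mono order_trans)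
  then have "(\<Sum>a\<in>S. Im a) / 2 - 120 / N * Re (F (\<i>/2)) \<le> 0"
    by (simp flip: exp_add)
  then show ?thesis by simp
qed

section \<open>Weak type estimate on vertical segments\<close>

lemma green_comparison_open:
  fixes F :: "complex \<Rightarrow> complex"
  defines "U \<equiv> {z. cmod z < 2 \<and> Im z > 0}"
  assumes hol: "F holomorphic_on U" and pos: "\<And>z. z \<in> U \<Longrightarrow> Re (F z) > 0"
    and fin: "finite S" and S: "\<And>a. a \<in> S \<Longrightarrow> \<bar>Re a\<bar> \<le> 1/4 \<and> 0 < Im a \<and> Im a \<le> 1/8"
    and sep: "\<And>a b. a \<in> S \<Longrightarrow> b \<in> S \<Longrightarrow> a \<noteq> b \<Longrightarrow> \<bar>Re a - Re b\<bar> \<ge> 2 * (Im a + Im b)"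
    and "N > 0" and N: "\<And>a. a \<in> S \<Longrightarrow> Re (F a) \<ge> N"
  shows "(\<Sum>a\<in>S. Im a) \<le> 240 * Re (F (\<i>/2)) / N"
  \<comment> \<open>\<open>F\<close> need not extend to the real line, so shift it by \<open>\<i> \<epsilon>\<close> and let \<open>\<epsilon>\<close> tend to 0.\<close>
proof (rule tendsto_le)
  have "open U" unfolding U_def
    by (intro open_Collect_conj open_Collect_less continuous_intros)
  moreover have "\<i>/2 \<in> U" by (simp add: U_def norm_divide)
  ultimately have "isCont F (\<i>/2)"
    using hol holomorphic_on_imp_continuous_on continuous_on_eq_continuous_at by blast
  moreover have "((\<lambda>\<epsilon>. \<i>/2 + \<i> * of_real \<epsilon>) \<longlongrightarrow> \<i>/2 + \<i> * of_real 0) (at_right 0)"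
    by (intro tendsto_intros)
  ultimately have "((\<lambda>\<epsilon>. F (\<i>/2 + \<i> * of_real \<epsilon>)) \<longlongrightarrow> F (\<i>/2)) (at_right 0)"
    by (intro isCont_tendsto_compose[of "\<i>/2" F]) simp_all
  then show "((\<lambda>\<epsilon>. 240 * Re (F (\<i>/2 + \<i> * of_real \<epsilon>)) / N) \<longlongrightarrow> 240 * Re (F (\<i>/2)) / N) (at_right 0)"
    using \<open>N > 0\<close> by (intro tendsto_intros) auto
  have "((\<lambda>\<epsilon>. \<Sum>a\<in>S. Im a - \<epsilon>) \<longlongrightarrow> (\<Sum>a\<in>S. Im a - 0)) (at_right 0)"
    by (intro tendsto_intros)
  then show "((\<lambda>\<epsilon>. \<Sum>a\<in>S. Im a - \<epsilon>) \<longlongrightarrow> (\<Sum>a\<in>S. Im a)) (at_right 0)" by simp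
  have "\<forall>\<^sub>F \<epsilon> in at_right (0::real). \<forall>a\<in>S. \<epsilon> < Im a"
    using fin S by (intro eventually_ball_finite ballI eventually_at_rightI[of 0 "Im a" for a]) auto
  moreover have "\<forall>\<^sub>F \<epsilon> in at_right (0::real). \<epsilon> < 1/2"
    by (rule eventually_at_rightI[of 0 "1/2"]) auto
  moreover have "\<forall>\<^sub>F \<epsilon> in at_right (0::real). 0 < \<epsilon>"
    by (rule eventually_at_right_less)
  ultimately show "\<forall>\<^sub>F \<epsilon> in at_right 0. (\<Sum>a\<in>S. Im a - \<epsilon>) \<le> 240 * Re (F (\<i>/2 + \<i> * of_real \<epsilon>)) / N"
  proof eventually_elim
    case (elim \<epsilon>)
    \<comment> \<open>The poles move down by \<open>\<epsilon>\<close> while \<open>F\<close> is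
      evaluated \<open>\<epsilon>\<close> higher, so the values at the poles are unchanged. Real
      parts stay and heights shrink, hence the separation survives.\<close>
    define s s' :: "complex \<Rightarrow> complex"
      where "s = (\<lambda>z. z + \<i> * of_real \<epsilon>)" and "s' = (\<lambda>z. z - \<i> * of_real \<epsilon>)"
    have inj: "inj_on s' S" by (auto simp: inj_on_def s'_def)
    have sU: "s z \<in> U" if "cmod z \<le> 1" "Im z \<ge> 0" for z
    proof -
      have "cmod (s z) \<le> cmod z + \<epsilon>"
        using norm_triangle_ineq[of z "\<i> * of_real \<epsilon>"] elim by (simp add: s_def norm_mult)
      then show ?thesis using that elim by (simp add: U_def s_def)
    qed
    have "(\<Sum>a\<in>s' ` S. Im a) \<le> 240 * Re ((F \<circ> s) (\<i>/2)) / N"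
    proof (rule green_comparison)
      show "(F \<circ> s) holomorphic_on {z. cmod z < 1 \<and> 0 < Im z}"
        by (rule holomorphic_on_compose_gen[OF _ hol])
          (use sU in \<open>auto simp: s_def intro!: holomorphic_intros\<close>)
      show "continuous_on {z. cmod z \<le> 1 \<and> 0 \<le> Im z} (F \<circ> s)"
        by (rule continuous_on_compose2[OF holomorphic_on_imp_continuous_on[OF hol], folded o_def])
          (use sU in \<open>auto simp: s_def intro!: continuous_intros\<close>)
      show "0 < Re ((F \<circ> s) z)" if "z \<in> {z. cmod z \<le> 1 \<and> 0 \<le> Im z}" for z
        using that sU pos by auto
      show "2 * (Im a + Im b) \<le> \<bar>Re a - Re b\<bar>" if "a \<in> s' ` S" "b \<in> s' ` S" "a \<noteq> b" for a b
        using that sep elim by (fastforce simp: s'_def)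
      show "N \<le> Re ((F \<circ> s) a)" if "a \<in> s' ` S" for a
        using that N by (auto simp: s_def s'_def)
      show "\<bar>Re a\<bar> \<le> 1/4 \<and> 0 < Im a \<and> Im a \<le> 1/8" if "a \<in> s' ` S" for a
        using that S elim by (fastforce simp: s'_def)
    qed (use fin \<open>N > 0\<close> in auto)
    then show ?case unfolding sum.reindex[OF inj] by (simp add: s_def s'_def)
  qed
qed auto

text \<open>Vitali's lemma selects points with disjoint intervals of radius \<open>2 * Im a\<close>,
  which is exactly the separation that the Green comparison requires. The fivefold enlarged
  intervals have length \<open>20 * Im a\<close>, whence 4800 = 20 * 240.\<close>

lemma vertical_maximal_estimate:
  fixes F :: "complex \<Rightarrow> complex"
  defines "U \<equiv> {z. cmod z < 2 \<and> Im z > 0}"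
  assumes hol: "F holomorphic_on U" and pos: "\<And>z. z \<in> U \<Longrightarrow> Re (F z) > 0" and "N > 0"
  shows "\<exists>W. W \<in> lmeasurable \<and> measure lebesgue W \<le> 4800 * Re (F (\<i>/2)) / N \<and>
    {x. \<bar>x\<bar> \<le> 1/4 \<and> (\<exists>y. 0 < y \<and> y \<le> 1/8 \<and> Re (F (Complex x y)) \<ge> N)} \<subseteq> W"
proof -
  define T where "T = {a. \<bar>Re a\<bar> \<le> 1/4 \<and> 0 < Im a \<and> Im a \<le> 1/8 \<and> Re (F a) \<ge> N}"
  have r: "0 < 2 * Im a \<and> 2 * Im a \<le> 1" if "a \<in> T" for a using that by (auto simp: T_def)
  obtain C where C: "countable C" "C \<subseteq> T"
      and disj: "pairwise (\<lambda>a b. disjnt (cball (Re a) (2 * Im a)) (cball (Re b) (2 * Im b))) C"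
      and cov: "\<And>a. a \<in> T \<Longrightarrow> \<exists>b. b \<in> C \<and> \<not> disjnt (cball (Re a) (2 * Im a)) (cball (Re b) (2 * Im b))
        \<and> cball (Re a) (2 * Im a) \<subseteq> ball (Re b) (5 * (2 * Im b))"
    by (rule Vitali_covering_lemma_cballs_balls[of T "\<lambda>a. 2 * Im a" 1 Re, OF r]) (assumption, rule that)
  have sep: "2 * (Im a + Im b) \<le> \<bar>Re a - Re b\<bar>" if "a \<in> C" "b \<in> C" "a \<noteq> b" for a b
  proof (rule ccontr)
    assume *: "\<not> ?thesis"
    have "Im a > 0" "Im b > 0" using that C r by auto
    moreover have "Re a - Re b < 2 * Im a + 2 * Im b" "Re b - Re a < 2 * Im a + 2 * Im b"
      using * by auto
    \<comment> \<open>Two intervals whose centres are too close share the larger of their left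
      endpoints.\<close>
    ultimately have "max (Re a - 2 * Im a) (Re b - 2 * Im b) \<in> cball (Re a) (2 * Im a) \<inter> cball (Re b) (2 * Im b)"
      by (auto simp: dist_real_def abs_le_iff max_def)
    moreover have "cball (Re a) (2 * Im a) \<inter> cball (Re b) (2 * Im b) = {}"
      using disj that by (auto simp: pairwise_def disjnt_def)
    ultimately show False by blast
  qed
  \<comment> \<open>The bound does not depend on the finite subfamily, so it passes to the countable
    union \<open>W\<close>.\<close>
  have bound: "measure lebesgue (\<Union>a\<in>D. ball (Re a) (10 * Im a)) \<le> 4800 * Re (F (\<i>/2)) / N"
    if D: "D \<subseteq> C" "finite D" for D
  proof -
    have "measure lebesgue (\<Union>a\<in>D. ball (Re a) (10 * Im a)) \<le> (\<Sum>a\<in>D. measure lebesgue (ball (Re a) (10 * Im a)))"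
      using D by (intro measure_UNION_le) auto
    also have "\<dots> = (\<Sum>a\<in>D. 20 * Im a)"
      using D C r by (intro sum.cong refl) (fastforce simp: ball_eq_greaterThanLessThan T_def)
    also have "\<dots> = 20 * (\<Sum>a\<in>D. Im a)" by (simp add: sum_distrib_left)
    also have "\<dots> \<le> 20 * (240 * Re (F (\<i>/2)) / N)"
    proof (intro mult_left_mono green_comparison_open)
      show "2 * (Im a + Im b) \<le> \<bar>Re a - Re b\<bar>" if "a \<in> D" "b \<in> D" "a \<noteq> b" for a b
        using that D sep by blast
    qed (use hol pos \<open>N > 0\<close> D C in \<open>auto simp: T_def U_def\<close>)
    finally show ?thesis by simp
  qed
  define W where "W = (\<Union>a\<in>C. ball (Re a) (10 * Im a))"
  have "W \<in> lmeasurable" unfolding W_def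
    by (rule fmeasurable_UN_bound[OF \<open>countable C\<close> _ bound]) auto
  moreover have "measure lebesgue W \<le> 4800 * Re (F (\<i>/2)) / N" unfolding W_def
    by (rule measure_UN_bound[OF \<open>countable C\<close> _ bound]) auto
  moreover have "x \<in> W" if "\<bar>x\<bar> \<le> 1/4" "0 < y" "y \<le> 1/8" "Re (F (Complex x y)) \<ge> N" for x y
  proof -
    have "Complex x y \<in> T" using that by (simp add: T_def)
    from cov[OF this] obtain b where "b \<in> C" "cball x (2 * y) \<subseteq> ball (Re b) (5 * (2 * Im b))" by auto
    moreover have "x \<in> cball x (2 * y)" using that by simp
    ultimately have "x \<in> ball (Re b) (5 * (2 * Im b))" by blast
    then have "x \<in> ball (Re b) (10 * Im b)" by simp
    with \<open>b \<in> C\<close> show ?thesis unfolding W_def by blast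
  qed
  ultimately show ?thesis by blast
qed

text \<open>The exceptional set lies in the superlevel set of every \<open>N\<close>, whose outer
  measure is at most a constant over \<open>N\<close>.\<close>

lemma negligible_vertically_unbounded:
  fixes F :: "complex \<Rightarrow> complex"
  defines "U \<equiv> {z. cmod z < 2 \<and> Im z > 0}"
  assumes hol: "F holomorphic_on U" and pos: "\<And>z. z \<in> U \<Longrightarrow> Re (F z) > 0"
  shows "negligible {x. \<bar>x\<bar> \<le> 1/4 \<and> (\<forall>N. \<exists>y. 0 < y \<and> y \<le> 1/8 \<and> Re (F (Complex x y)) \<ge> N)}"
    (is "negligible ?A")
  unfolding negligible_outer_le
proof (intro allI impI)
  fix e :: real assume "e > 0"
  have v: "Re (F (\<i>/2)) > 0" by (rule pos) (simp add: U_def norm_divide)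
  define N where "N = 4800 * Re (F (\<i>/2)) / e"
  have "N > 0" using v \<open>e > 0\<close> by (simp add: N_def)
  from vertical_maximal_estimate[OF hol[unfolded U_def] pos[unfolded U_def] this]
  obtain W where "W \<in> lmeasurable" "measure lebesgue W \<le> 4800 * Re (F (\<i>/2)) / N"
    "{x. \<bar>x\<bar> \<le> 1/4 \<and> (\<exists>y. 0 < y \<and> y \<le> 1/8 \<and> Re (F (Complex x y)) \<ge> N)} \<subseteq> W" by auto
  moreover have "4800 * Re (F (\<i>/2)) / N = e" using v \<open>e > 0\<close> by (simp add: N_def)
  ultimately show "\<exists>T. ?A \<subseteq> T \<and> T \<in> lmeasurable \<and> measure lebesgue T \<le> e"
    by (intro exI[of _ W]) auto
qed

subsection \<open>Radial growth and polar omitted sets\<close>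

text \<open>Otherwise radial unboundedness of \<open>f\<close> would make a positive harmonic
  function unbounded on almost every radius ending on an arc close to \<open>\<zeta>\<close>,
  against the weak type estimate.\<close>

lemma AE_radially_unbounded_imp_polar:
  assumes f: "f holomorphic_on ball 0 1"
    and unb: "AE t in lebesgue_on {0..2*pi}.
      \<not> bounded {f (complex_of_real r * cis t) | r. 0 \<le> r \<and> r < 1}"
    and \<zeta>: "cmod \<zeta> = 1" and "r > 0"
  shows "polar (- f ` D_disc \<zeta> r)"
proof (rule ccontr)
  assume "\<not> ?thesis"
  then obtain \<nu> K M where \<nu>: "finite_measure \<nu>" "sets \<nu> = sets borel" "compact K" "AE k in \<nu>. k \<in> K"
    and K: "K \<subseteq> - f ` D_disc \<zeta> r" and m: "measure \<nu> UNIV > 0"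
    and M: "\<And>w. w \<notin> K \<Longrightarrow> - M \<le> (\<integral>k. ln (cmod (w - k)) \<partial>\<nu>)"
    by (rule nonpolar_imp_bounded_potential) blast
  obtain R where R: "R \<ge> 1" "AE k in \<nu>. cmod k \<le> R"
  proof -
    obtain R where "\<And>z. z \<in> K \<Longrightarrow> cmod z \<le> R"
      using compact_imp_bounded[OF \<nu>(3)] by (auto simp: bounded_iff)
    with \<nu>(4) have "AE k in \<nu>. cmod k \<le> max 1 R" by (auto elim!: eventually_mono simp: le_max_iff_disj)
    then show ?thesis using that[of "max 1 R"] by simp
  qed
  obtain t0 where t0: "\<zeta> = cis t0" "0 \<le> t0" "t0 < 2 * pi"
    using Arg2pi[of \<zeta>] \<zeta> that[of "Arg2pi \<zeta>"] by (simp add: is_Arg_def cis_conv_exp)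
  \<comment> \<open>If \<open>\<zeta> = 1\<close>, then \<open>t0\<close> is an endpoint of the
    parameter interval. Moving to an interior \<open>t1\<close> leaves room for an interval of
    angles inside \<open>{0..2*pi}\<close>.\<close>
  obtain t1 where t1: "0 < t1" "t1 < 2 * pi" "dist (cis t1) \<zeta> < r / 2"
  proof -
    have "isCont cis t0" unfolding cis_conv_exp[abs_def] by (intro continuous_intros)
    then obtain \<eta> where \<eta>: "\<eta> > 0" "\<And>t. dist t t0 < \<eta> \<Longrightarrow> dist (cis t) (cis t0) < r / 2"
      using \<open>r > 0\<close> unfolding continuous_at_eps_delta by (metis half_gt_zero)
    define t where "t = t0 + min \<eta> (2 * pi - t0) / 2"
    have "0 < min \<eta> (2 * pi - t0)" "min \<eta> (2 * pi - t0) \<le> \<eta>" "min \<eta> (2 * pi - t0) \<le> 2 * pi - t0"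
      using \<eta>(1) t0 by simp_all
    then have "0 < t" "t < 2 * pi" "dist t t0 < \<eta>"
      unfolding t_def dist_real_def using t0 by argo+
    with \<eta>(2) t0(1) show ?thesis using that by blast
  qed
  \<comment> \<open>The scale \<open>\<delta>\<close> has to keep both the image of the half-disc of
    radius 2 near \<open>\<zeta>\<close> and the angles near \<open>t1\<close> inside the parameter
    interval.\<close>
  obtain \<delta> where \<delta>: "\<delta> > 0" "\<delta> \<le> t1" "\<delta> \<le> 2 * pi - t1"
    "\<And>w. cmod w < 2 \<Longrightarrow> dist (cis t1 * exp (\<i> * of_real \<delta> * w)) (cis t1) < r / 2"
  proof -
    have "isCont (\<lambda>z. cis t1 * exp (\<i> * z)) 0" by (intro continuous_intros)
    then obtain \<eta> where \<eta>: "\<eta> > 0" "\<And>z. dist z 0 < \<eta> \<Longrightarrow> dist (cis t1 * exp (\<i> * z)) (cis t1 * exp (\<i> * 0)) < r / 2"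
      using \<open>r > 0\<close> unfolding continuous_at_eps_delta by (metis half_gt_zero)
    define \<delta> where "\<delta> = min (\<eta> / 2) (min t1 (2 * pi - t1))"
    have \<delta>: "\<delta> > 0" "\<delta> \<le> t1" "\<delta> \<le> 2 * pi - t1" "\<delta> \<le> \<eta> / 2"
      unfolding \<delta>_def using \<eta>(1) t1 by (simp_all add: min_le_iff_disj del: le_divide_eq_numeral1)
    have "dist (cis t1 * exp (\<i> * of_real \<delta> * w)) (cis t1) < r / 2" if "cmod w < 2" for w
    proof -
      have "\<delta> * cmod w < \<delta> * 2" using that \<delta>(1) by simp
      also have "\<delta> * 2 \<le> \<eta>" using \<delta> by simp
      finally have "dist (of_real \<delta> * w) 0 < \<eta>" using \<delta>(1) by (simp add: norm_mult)
      from \<eta>(2)[OF this] show ?thesis by (simp add: mult.assoc)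
    qed
    with \<delta> show ?thesis using that by blast
  qed
  define U where "U = {z. cmod z < 2 \<and> Im z > 0}"
  have "U = ball 0 2 \<inter> {z. Im z > 0}" by (auto simp: U_def)
  then have U: "open U" "convex U"
    by (auto simp: open_halfspace_Im_gt convex_halfspace_Im_gt convex_Int)
  \<comment> \<open>Vertical half-lines are mapped to radii.\<close>
  define \<phi> where "\<phi> w = cis t1 * exp (\<i> * of_real \<delta> * w)" for w
  have \<phi>: "\<phi> w \<in> D_disc \<zeta> r" if "w \<in> U" for w
  proof -
    have "cmod (\<phi> w) < 1" using that \<delta>(1) by (simp add: \<phi>_def U_def norm_mult)
    moreover have "dist (\<phi> w) (cis t1) < r / 2" using \<delta>(4) that by (simp add: \<phi>_def U_def)
    then have "dist (\<phi> w) \<zeta> < r"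
      using dist_triangle_half_l[of "\<phi> w" "cis t1" r \<zeta>] t1(3) by (simp add: dist_commute)
    ultimately show ?thesis by (simp add: D_disc_def dist_norm)
  qed
  define g where "g = f \<circ> \<phi>"
  have "g holomorphic_on U"
    unfolding g_def
  proof (rule holomorphic_on_compose_gen[OF _ f])
    show "\<phi> holomorphic_on U" unfolding \<phi>_def by (intro holomorphic_intros)
  qed (use \<phi> in \<open>auto simp: D_disc_def\<close>)
  moreover have gK: "g ` U \<inter> K = {}" using \<phi> K by (fastforce simp: g_def)
  ultimately obtain F where F: "F holomorphic_on U" "\<And>z. z \<in> U \<Longrightarrow> Re (F z) = (\<integral>k. ln (cmod (g z - k)) \<partial>\<nu>)"
    using holomorphic_log_potential[OF \<nu> U] by blast
  \<comment> \<open>Adding \<open>M + 1\<close> makes the real part at least 1, hence strictly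
    positive.\<close>
  define F' where "F' z = F z + of_real (M + 1)" for z
  define A where "A = {x. \<bar>x\<bar> \<le> 1/4 \<and> (\<forall>N. \<exists>y. 0 < y \<and> y \<le> 1/8 \<and> Re (F' (Complex x y)) \<ge> N)}"
  have "negligible A"
    unfolding A_def
  proof (rule negligible_vertically_unbounded[where F = F'])
    show "F' holomorphic_on {z. cmod z < 2 \<and> Im z > 0}"
      using F(1) unfolding F'_def U_def by (intro holomorphic_intros)
    show "0 < Re (F' z)" if "z \<in> {z. cmod z < 2 \<and> Im z > 0}" for z
    proof -
      have "z \<in> U" using that by (simp add: U_def)
      then show ?thesis using F(2) M[of "g z"] gK by (force simp: F'_def)
    qed
  qed
  have in_A: "x \<in> A" if x: "\<bar>x\<bar> \<le> 1/4"
    and ub: "\<not> bounded {f (complex_of_real \<rho> * cis (t1 + \<delta> * x)) | \<rho>. 0 \<le> \<rho> \<and> \<rho> < 1}" for x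
    unfolding A_def
  proof (intro CollectI conjI allI x)
    fix N
    \<comment> \<open>This is the modulus of \<open>\<phi>\<close> at height 1/8. Since
      \<open>f\<close> is bounded on the disc of radius \<open>s\<close>, large values on a radius
      occur beyond it, that is, at heights below 1/8.\<close>
    define s where "s = exp (- \<delta> / 8)"
    have "s < 1" using \<delta>(1) by (simp add: s_def)
    then have "continuous_on (cball 0 s) f"
      by (intro holomorphic_on_imp_continuous_on holomorphic_on_subset[OF f]) auto
    then have "bounded (f ` cball 0 s)"
      by (intro compact_imp_bounded compact_continuous_image) auto
    then obtain B where B: "\<And>z. cmod z \<le> s \<Longrightarrow> cmod (f z) \<le> B" by (force simp: bounded_iff)
    \<comment> \<open>The first entry puts the value of \<open>g\<close> in the range of the lower
      bound for the potential; the second makes that bound at least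
      \<open>N - M - 1\<close>.\<close>
    define T where "T = max (2 * R) (2 * exp ((N - M - 1) / measure \<nu> UNIV))"
    obtain \<rho> where \<rho>: "0 \<le> \<rho>" "\<rho> < 1" and big: "cmod (f (of_real \<rho> * cis (t1 + \<delta> * x))) > max B T"
    proof -
      have "\<exists>w\<in>{f (complex_of_real \<rho> * cis (t1 + \<delta> * x)) | \<rho>. 0 \<le> \<rho> \<and> \<rho> < 1}. cmod w > max B T"
        using ub unfolding bounded_iff by (meson not_le)
      then show ?thesis using that by blast
    qed
    have "s < \<rho>"
      using B[of "of_real \<rho> * cis (t1 + \<delta> * x)"] big \<rho> by (force simp: norm_mult not_le[symmetric])
    have "0 < s" by (simp add: s_def)
    with \<open>s < \<rho>\<close> have "\<rho> > 0" by simp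
    define y where "y = - ln \<rho> / \<delta>"
    have "ln \<rho> < 0" using \<rho> \<open>\<rho> > 0\<close> by simp
    then have "0 < y" using \<delta>(1) by (simp add: y_def divide_neg_pos)
    have "ln s < ln \<rho>" using \<open>s < \<rho>\<close> \<open>0 < s\<close> by simp
    then have y8: "y \<le> 1/8" using \<delta>(1) by (simp add: y_def s_def divide_simps)
    have "\<delta> * y = - ln \<rho>" using \<delta>(1) by (simp add: y_def)
    then have "\<phi> (Complex x y) = cis t1 * exp (of_real (ln \<rho>) + \<i> * of_real (\<delta> * x))"
      unfolding \<phi>_def by (simp add: complex_eq_iff Complex_eq algebra_simps Re_exp Im_exp)
    also have "\<dots> = of_real \<rho> * cis (t1 + \<delta> * x)"
      using \<open>\<rho> > 0\<close> by (simp add: exp_add cis_conv_exp exp_of_real algebra_simps)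
    finally have g: "cmod (g (Complex x y)) > T" using big by (simp add: g_def)
    have "cmod (Complex x y) \<le> \<bar>x\<bar> + \<bar>y\<bar>" using cmod_le[of "Complex x y"] by simp
    then have xyU: "Complex x y \<in> U" using x y8 \<open>0 < y\<close> by (simp add: U_def)
    define W where "W = cmod (g (Complex x y))"
    have W: "2 * R \<le> W" "2 * exp ((N - M - 1) / measure \<nu> UNIV) \<le> W" using g by (auto simp: T_def W_def)
    have "(N - M - 1) / measure \<nu> UNIV \<le> ln (W / 2)"
      using W R(1) by (subst ln_ge_iff) auto
    then have "N - M - 1 \<le> measure \<nu> UNIV * ln (W / 2)"
      using m by (simp add: pos_divide_le_eq mult.commute)
    also have "\<dots> \<le> Re (F (Complex x y))"
      using log_potential_lower_bound[OF \<nu>(1,2) R(2,1)] W(1) F(2)[OF xyU] by (simp add: W_def)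
    finally have "N \<le> Re (F' (Complex x y))" by (simp add: F'_def)
    with \<open>0 < y\<close> y8 show "\<exists>y. 0 < y \<and> y \<le> 1/8 \<and> N \<le> Re (F' (Complex x y))" by blast
  qed
  obtain Z where Z: "negligible Z"
    "\<And>t. t \<in> {0..2*pi} \<Longrightarrow> bounded {f (complex_of_real r * cis t) | r. 0 \<le> r \<and> r < 1} \<Longrightarrow> t \<in> Z"
  proof -
    have "AE t in lebesgue. t \<in> {0..2*pi} \<longrightarrow> \<not> bounded {f (complex_of_real r * cis t) | r. 0 \<le> r \<and> r < 1}"
      using unb by (subst (asm) AE_restrict_space_iff) auto
    then obtain Z where "Z \<in> sets lebesgue" "emeasure lebesgue Z = 0"
      "{t \<in> space lebesgue. \<not> (t \<in> {0..2*pi} \<longrightarrow> \<not> bounded {f (complex_of_real r * cis t) | r. 0 \<le> r \<and> r < 1})} \<subseteq> Z"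
      by (rule AE_E)
    then show ?thesis using that[of Z] by (auto simp: negligible_iff_null_sets null_sets_def)
  qed
  \<comment> \<open>An angle in this nondegenerate interval either has a bounded radius and lies in
    \<open>Z\<close>, or comes from a point of \<open>A\<close>; both sets are negligible, which is
    the contradiction.\<close>
  have "{t1 - \<delta>/4 .. t1 + \<delta>/4} \<subseteq> (\<lambda>x. t1 + \<delta> * x) ` A \<union> Z"
  proof
    fix t assume t: "t \<in> {t1 - \<delta>/4 .. t1 + \<delta>/4}"
    define x where "x = (t - t1) / \<delta>"
    have tx: "t = t1 + \<delta> * x" using \<delta>(1) by (simp add: x_def)
    have "t1 - \<delta>/4 \<le> t" "t \<le> t1 + \<delta>/4" using t by auto
    then have "\<bar>t - t1\<bar> \<le> \<delta> * (1/4)" by argo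
    then have "\<bar>x\<bar> \<le> 1/4" using \<delta>(1) by (simp add: tx abs_mult)
    moreover have "t \<in> {0..2*pi}" using t \<delta> by auto
    ultimately show "t \<in> (\<lambda>x. t1 + \<delta> * x) ` A \<union> Z" using in_A Z(2) tx by blast
  qed
  moreover have "negligible ((\<lambda>x. t1 + \<delta> * x) ` A \<union> Z)"
    using \<open>negligible A\<close> Z(1)
    by (intro negligible_Un negligible_differentiable_image_negligible) (auto intro!: derivative_intros)
  ultimately have "negligible {t1 - \<delta>/4 .. t1 + \<delta>/4}" using negligible_subset by blast
  then show False using \<delta>(1) negligible_interval(1)[of "t1 - \<delta>/4" "t1 + \<delta>/4"] by simp
qed

text \<open>It suffices to approximate the countably many constant functions with positive integer
  values; the exceptional null sets are then combined.\<close>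

lemma U_ae_radially_unbounded:
  assumes "f \<in> U_ae"
  shows "AE t in lebesgue_on {0..2*pi}.
    \<not> bounded {f (complex_of_real r * cis t) | r. 0 \<le> r \<and> r < 1}"
proof -
  have "AE t in lebesgue_on {0..2*pi}. \<exists>r. 0 \<le> r \<and> r < 1 \<and> cmod (f (of_real r * cis t)) > real n" for n
  proof -
    \<comment> \<open>The target \<open>Suc n\<close> makes the moduli eventually exceed
      \<open>n\<close> strictly.\<close>
    have "circ_measurable (\<lambda>_. of_nat (Suc n))" by (simp add: circ_measurable_def)
    then obtain r :: "nat \<Rightarrow> real" where r: "\<And>n. 0 \<le> r n \<and> r n < 1"
      and lim: "AE t in lebesgue_on {0..2*pi}. (\<lambda>i. f (of_real (r i) * cis t)) \<longlonglongrightarrow> of_nat (Suc n)"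
      using assms unfolding U_ae_def by blast
    from lim show ?thesis
    proof eventually_elim
      case (elim t)
      from tendsto_norm[OF elim] have "\<forall>\<^sub>F i in sequentially. real n < cmod (f (of_real (r i) * cis t))"
        by (rule order_tendstoD(1)) (simp del: of_nat_Suc)
      then show ?case using r by (auto simp: eventually_sequentially)
    qed
  qed
  then have "AE t in lebesgue_on {0..2*pi}. \<forall>n. \<exists>r. 0 \<le> r \<and> r < 1 \<and> cmod (f (of_real r * cis t)) > real n"
    by (simp add: AE_all_countable)
  then show ?thesis
  proof eventually_elim
    case (elim t)
    show ?case
    proof
      assume "bounded {f (complex_of_real r * cis t) | r. 0 \<le> r \<and> r < 1}"
      then obtain B where B: "\<And>r. 0 \<le> r \<Longrightarrow> r < 1 \<Longrightarrow> cmod (f (of_real r * cis t)) \<le> B"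
        by (auto simp: bounded_iff)
      obtain n where "B \<le> real n" using real_arch_simple by blast
      with elim B show False by (meson not_le order_trans)
    qed
  qed
qed

theorem theorem5p2:
  shows "(\<forall>f. f holomorphic_on ball 0 1 \<and>
            (AE t in lebesgue_on {0..2*pi}.
               \<not> bounded {f (complex_of_real r * cis t) | r. 0 \<le> r \<and> r < 1})
          \<longrightarrow> (\<forall>\<zeta> r. cmod \<zeta> = 1 \<and> r > 0 \<longrightarrow> polar (- f ` D_disc \<zeta> r)))
       \<and> (\<forall>f \<in> U_ae. \<forall>\<zeta> r. cmod \<zeta> = 1 \<and> r > 0 \<longrightarrow> polar (- f ` D_disc \<zeta> r))"
proof (intro conjI allI ballI impI)
  fix f :: "complex \<Rightarrow> complex" and \<zeta> :: complex and r :: real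
  assume "cmod \<zeta> = 1 \<and> r > 0"
  then have \<zeta>: "cmod \<zeta> = 1" "r > 0" by auto
  show "polar (- f ` D_disc \<zeta> r)"
    if "f holomorphic_on ball 0 1 \<and> (AE t in lebesgue_on {0..2*pi}.
      \<not> bounded {f (complex_of_real r * cis t) | r. 0 \<le> r \<and> r < 1})"
    using AE_radially_unbounded_imp_polar[OF conjunct1[OF that] conjunct2[OF that] \<zeta>] .
  show "polar (- f ` D_disc \<zeta> r)" if f: "f \<in> U_ae"
  proof -
    have "f holomorphic_on ball 0 1" using f by (simp add: U_ae_def)
    from AE_radially_unbounded_imp_polar[OF this U_ae_radially_unbounded[OF f] \<zeta>] show ?thesis .
  qed
qed

end
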